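(* Let $0\le \mu\in L^1(\mathbb{R}^N)$ be the density of a probability measure $d\mu=\mu(x)\,dx$ on $\mathbb{R}^N$ such that: (a) $\mu\in H^1_{\rm loc}(\mathbb{R}^N)$ and $\frac{\nabla\mu}{\mu}\in L^r_{\rm loc}(\mathbb{R}^N,\mathbb{R}^N)$ for some $r>N$; (b) $\inf_{x\in K}\mu(x)>0$ for every compact $K\subset\mathbb{R}^N$. Let $A$ be the operator on $L^2_\mu(\mathbb{R}^N)$ associated with the form $a_L(u,v)=\int_{\mathbb{R}^N}Lu\,\overline{Lv}\,d\mu$, $u,v\in D(L)$. Then the semigroup $(e^{-tA})_{t\ge0}$ is asymptotically irreducible, i.e. $$f\in L^2_\mu(\mathbb{R}^N)_>\ \Longrightarrow\ \lim_{t\to+\infty}\mathrm{dist}\big(e^{-tA}f,\,L^2_\mu(\mathbb{R}^N)_>\big)=0.$$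
   Context: $L^2_\mu(\mathbb{R}^N)=L^2(\mathbb{R}^N,d\mu)$, and $L^2_\mu(\mathbb{R}^N)_>$ is the set of $f\in L^2_\mu(\mathbb{R}^N)$ with $f\ge0$ for which there is a Borel set $B\subset\mathbb{R}^N$ of positive Lebesgue measure with $f(x)>0$ for $x\in B$; $\mathrm{dist}$ is the distance in the $L^2_\mu$-norm. $(L,D(L))$ is the closure in $L^2_\mu(\mathbb{R}^N)$ of $Lf=\Delta f+\frac{\nabla\mu}{\mu}\cdot\nabla f$, $f\in C_c^\infty(\mathbb{R}^N)$; under (a)-(b) it is known to generate an analytic contraction $C_0$-semigroup on $L^2_\mu(\mathbb{R}^N)$. The operator $A$: $u\in D(A)$, $Au=f$ iff $u\in D(L)$, $f\in L^2_\mu(\mathbb{R}^N)$ and $\int_{\mathbb{R}^N}Lu\,\overline{Lv}\,d\mu=\int_{\mathbb{R}^N}f\,\overline v\,d\mu$ for all $v\in D(L)$. The operator $-A$ generates an analytic contraction $C_0$-semigroup $(e^{-tA})_{t\ge0}$ on $L^2_\mu(\mathbb{R}^N)$. *)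

theory Defs
  imports "HOL-Probability.Probability"
begin

text \<open>
  The space \<open>\<real>\<^sup>N\<close> is a type \<open>'a :: euclidean_space\<close> with \<open>N = DIM('a)\<close>. Elements of \<open>L\<^sup>2\<close> are
  represented by measurable functions, and equality in \<open>L\<^sup>2\<close> is equality almost everywhere.
  Unbounded operators are represented by their graphs, which are closed under changing either
  component on a null set.
\<close>

section \<open>Test functions and local Sobolev regularity\<close>

definition partial_deriv :: "'a \<Rightarrow> ('a::euclidean_space \<Rightarrow> 'b::real_normed_vector) \<Rightarrow> 'a \<Rightarrow> 'b" where
  "partial_deriv b f x = frechet_derivative f (at x) b"

primrec C_k :: "nat \<Rightarrow> ('a::euclidean_space \<Rightarrow> 'b::real_normed_vector) \<Rightarrow> bool" where
  "C_k 0 f \<longleftrightarrow> continuous_on UNIV f"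
| "C_k (Suc k) f \<longleftrightarrow> (\<forall>x. f differentiable (at x)) \<and> (\<forall>b\<in>Basis. C_k k (partial_deriv b f))"

definition test_functions :: "('a::euclidean_space \<Rightarrow> 'b::real_normed_vector) set" where
  "test_functions = {\<phi>. (\<forall>k. C_k k \<phi>) \<and> compact (closure {x. \<phi> x \<noteq> 0})}"

definition Lp_loc :: "real \<Rightarrow> ('a::euclidean_space \<Rightarrow> 'b::real_normed_vector) set" where
  "Lp_loc p = {f \<in> borel_measurable borel.
     \<forall>K. compact K \<longrightarrow> set_integrable lborel K (\<lambda>x. norm (f x) powr p)}"

definition weak_gradient :: "('a::euclidean_space \<Rightarrow> real) \<Rightarrow> ('a \<Rightarrow> 'a) \<Rightarrow> bool" where
  "weak_gradient f g \<longleftrightarrow> f \<in> Lp_loc 1 \<and> g \<in> Lp_loc 1 \<and>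
     (\<forall>\<phi>\<in>test_functions. \<forall>b\<in>Basis.
        (\<integral>x. f x * partial_deriv b \<phi> x \<partial>lborel) = - (\<integral>x. (g x \<bullet> b) * \<phi> x \<partial>lborel))"

definition H1_loc :: "('a::euclidean_space \<Rightarrow> real) set" where
  "H1_loc = {f. f \<in> Lp_loc 2 \<and> (\<exists>g. weak_gradient f g \<and> g \<in> Lp_loc 2)}"

section \<open>Complex \<open>L\<^sup>2\<close> spaces\<close>

definition L2 :: "'a measure \<Rightarrow> ('a \<Rightarrow> complex) set" where
  "L2 M = {f \<in> borel_measurable M. integrable M (\<lambda>x. (norm (f x))\<^sup>2)}"

definition L2_norm :: "'a measure \<Rightarrow> ('a \<Rightarrow> complex) \<Rightarrow> real" where
  "L2_norm M f = sqrt (\<integral>x. (norm (f x))\<^sup>2 \<partial>M)"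

definition L2_inner :: "'a measure \<Rightarrow> ('a \<Rightarrow> complex) \<Rightarrow> ('a \<Rightarrow> complex) \<Rightarrow> complex" where
  "L2_inner M f g = (\<integral>x. f x * cnj (g x) \<partial>M)"

definition L2_infdist :: "'a measure \<Rightarrow> ('a \<Rightarrow> complex) \<Rightarrow> ('a \<Rightarrow> complex) set \<Rightarrow> real" where
  "L2_infdist M f S = (INF g\<in>S. L2_norm M (\<lambda>x. f x - g x))"

text \<open>
  The set \<open>L\<^sup>2(M)\<^sub>>\<close>. The inequality \<open>f \<ge> 0\<close> is the one between elements of \<open>L\<^sup>2\<close>, that is,
  almost everywhere; positivity of a complex number includes that it is real.
\<close>

definition L2_pos :: "'a::euclidean_space measure \<Rightarrow> ('a \<Rightarrow> complex) set" where
  "L2_pos M = {f \<in> L2 M.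
     (AE x in M. f x \<in> \<real> \<and> 0 \<le> Re (f x)) \<and>
     (\<exists>B\<in>sets borel. 0 < emeasure lborel B \<and> (\<forall>x\<in>B. f x \<in> \<real> \<and> 0 < Re (f x)))}"

section \<open>Operators and semigroups on \<open>L\<^sup>2\<close>\<close>

text \<open>
  The membership of the approximants in \<open>L\<^sup>2\<close> is demanded explicitly because the Bochner integral
  in \<open>L2_norm\<close> takes the value \<open>0\<close> on non-integrable arguments.
\<close>

definition graph_closure ::
    "'a measure \<Rightarrow> (('a \<Rightarrow> complex) \<times> ('a \<Rightarrow> complex)) set \<Rightarrow> (('a \<Rightarrow> complex) \<times> ('a \<Rightarrow> complex)) set" where
  "graph_closure M G = {(u, f). u \<in> L2 M \<and> f \<in> L2 M \<and>
     (\<exists>\<phi> \<psi>. (\<forall>n::nat. (\<phi> n, \<psi> n) \<in> G \<and> \<phi> n \<in> L2 M \<and> \<psi> n \<in> L2 M) \<and>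
        (\<lambda>n. L2_norm M (\<lambda>x. \<phi> n x - u x)) \<longlonglongrightarrow> 0 \<and>
        (\<lambda>n. L2_norm M (\<lambda>x. \<psi> n x - f x)) \<longlonglongrightarrow> 0)}"

definition C0_semigroup :: "'a measure \<Rightarrow> (real \<Rightarrow> ('a \<Rightarrow> complex) \<Rightarrow> ('a \<Rightarrow> complex)) \<Rightarrow> bool" where
  "C0_semigroup M T \<longleftrightarrow>
     (\<forall>t\<ge>0. \<forall>f\<in>L2 M. T t f \<in> L2 M) \<and>
     (\<forall>t\<ge>0. \<forall>f\<in>L2 M. \<forall>g\<in>L2 M. AE x in M. T t (\<lambda>y. f y + g y) x = T t f x + T t g x) \<and>
     (\<forall>t\<ge>0. \<forall>c. \<forall>f\<in>L2 M. AE x in M. T t (\<lambda>y. c * f y) x = c * T t f x) \<and>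
     (\<forall>t\<ge>0. \<exists>C. \<forall>f\<in>L2 M. L2_norm M (T t f) \<le> C * L2_norm M f) \<and>
     (\<forall>f\<in>L2 M. AE x in M. T 0 f x = f x) \<and>
     (\<forall>s\<ge>0. \<forall>t\<ge>0. \<forall>f\<in>L2 M. AE x in M. T (s + t) f x = T s (T t f) x) \<and>
     (\<forall>f\<in>L2 M. ((\<lambda>t. L2_norm M (\<lambda>x. T t f x - f x)) \<longlongrightarrow> 0) (at_right 0))"

definition generator ::
    "'a measure \<Rightarrow> (real \<Rightarrow> ('a \<Rightarrow> complex) \<Rightarrow> ('a \<Rightarrow> complex)) \<Rightarrow> (('a \<Rightarrow> complex) \<times> ('a \<Rightarrow> complex)) set" where
  "generator M T = {(u, f). u \<in> L2 M \<and> f \<in> L2 M \<and>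
     ((\<lambda>t. L2_norm M (\<lambda>x. (T t u x - u x) / of_real t - f x)) \<longlongrightarrow> 0) (at_right 0)}"

definition asymptotically_irreducible ::
    "'a::euclidean_space measure \<Rightarrow> (real \<Rightarrow> ('a \<Rightarrow> complex) \<Rightarrow> ('a \<Rightarrow> complex)) \<Rightarrow> bool" where
  "asymptotically_irreducible M T \<longleftrightarrow>
     (\<forall>f\<in>L2_pos M. ((\<lambda>t. L2_infdist M (T t f) (L2_pos M)) \<longlongrightarrow> 0) at_top)"

section \<open>The operators \<open>L\<close> and \<open>A\<close>\<close>

definition weighted_measure :: "('a::euclidean_space \<Rightarrow> real) \<Rightarrow> 'a measure" where
  "weighted_measure \<mu> = density lborel (\<lambda>x. ennreal (\<mu> x))"

text \<open>In the following, \<open>g\<close> is a representative of the weak gradient of \<open>\<mu>\<close>.\<close>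

definition L_test ::
    "('a::euclidean_space \<Rightarrow> real) \<Rightarrow> ('a \<Rightarrow> 'a) \<Rightarrow> ('a \<Rightarrow> complex) \<Rightarrow> 'a \<Rightarrow> complex" where
  "L_test \<mu> g \<phi> x =
     (\<Sum>b\<in>Basis. partial_deriv b (partial_deriv b \<phi>) x) +
     (\<Sum>b\<in>Basis. of_real ((g x \<bullet> b) / \<mu> x) * partial_deriv b \<phi> x)"

definition L_op ::
    "('a::euclidean_space \<Rightarrow> real) \<Rightarrow> ('a \<Rightarrow> 'a) \<Rightarrow> (('a \<Rightarrow> complex) \<times> ('a \<Rightarrow> complex)) set" where
  "L_op \<mu> g = graph_closure (weighted_measure \<mu>) {(\<phi>, L_test \<mu> g \<phi>) | \<phi>. \<phi> \<in> test_functions}"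

text \<open>The witness \<open>w\<close> stands for \<open>L u\<close>, and \<open>(v, z)\<close> ranges over the pairs \<open>(v, L v)\<close>.\<close>

definition A_op ::
    "('a::euclidean_space \<Rightarrow> real) \<Rightarrow> ('a \<Rightarrow> 'a) \<Rightarrow> (('a \<Rightarrow> complex) \<times> ('a \<Rightarrow> complex)) set" where
  "A_op \<mu> g = {(u, f). f \<in> L2 (weighted_measure \<mu>) \<and>
     (\<exists>w. (u, w) \<in> L_op \<mu> g \<and>
        (\<forall>(v, z)\<in>L_op \<mu> g.
           L2_inner (weighted_measure \<mu>) w z = L2_inner (weighted_measure \<mu>) f v))}"

end

theory Submission
  imports Defs
begin

text \<open>
  The generator \<open>-A\<close> is symmetric and dissipative, hence \<open>T t\<close> is a self-adjoint contraction and
  \<open>T t f\<close> converges, as \<open>t \<longlongrightarrow> \<infinity>\<close>, to the orthogonal projection of \<open>f\<close> onto the kernel of \<open>A\<close>,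
  which is the kernel of \<open>L\<close>. If \<open>\<phi>\<^sub>n \<longlongrightarrow> u\<close> and \<open>L \<phi>\<^sub>n \<longlongrightarrow> 0\<close> for test functions \<open>\<phi>\<^sub>n\<close>, then
  \<open>\<integral> \<bar>\<nabla>\<phi>\<^sub>n\<bar>\<^sup>2 d\<mu> = - Re \<langle>L \<phi>\<^sub>n, \<phi>\<^sub>n\<rangle> \<longlongrightarrow> 0\<close>, and as \<open>\<mu>\<close> is bounded below on balls, \<open>u\<close> is invariant
  under translations, that is, constant. So the limit of \<open>T t f\<close> is either the mean of \<open>f\<close> or \<open>0\<close>,
  depending on whether the constants lie in the domain of \<open>L\<close>. This question (essential
  self-adjointness) can be left open, since in both cases the limit is a nonnegative constant, which is
  approximated by positive constants.
\<close>

section \<open>Symmetric semigroups on a Hilbert space\<close>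

text \<open>The operator \<open>A\<close> is of fourth order, so no maximum principle is at hand and
  nothing is claimed about the sign of \<open>T t f\<close> at a finite time; positivity is
  recovered only in the limit. There the limit constant \<open>c\<close> is fixed by the semigroup
  and \<open>f - c\<close> is orthogonal to every complex multiple of \<open>c\<close>. With the
  mean \<open>m\<close> of \<open>f\<close>, which is nonnegative, this forces \<open>c\<close> to
  be real and equal to \<open>0\<close> or \<open>m\<close>. Self-adjointness and contractivity come
  without spectral theory, by differentiating orbits that start in the dense domain of the
  generator. Since \<open>C0_semigroup\<close> bounds each operator separately and states continuity
  only at time 0, this rests on a uniform operator bound near 0. The abstract part lives in a real
  Hilbert space with the product Re <f, g>; complex scalars return only when the limit is
  identified. There is no differentiability of \<open>u\<close> in the kernel of \<open>L\<close> to
  start from, so its constancy is shown through increments instead of a gradient.\<close>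

lemma tendsto_right_difference_quotient:
  assumes "(f has_vector_derivative D) (at a within {c..b})" "c \<le> a" "a < b"
  shows "((\<lambda>h. (f (a + h) - f a) /\<^sub>R h) \<longlongrightarrow> D) (at_right 0)"
proof -
  have lim: "((\<lambda>y. (f y - (f a + (y - a) *\<^sub>R D)) /\<^sub>R norm (y - a)) \<longlongrightarrow> 0) (at a within {c..b})"
    using assms(1) by (simp add: has_vector_derivative_def has_derivative_within divide_inverse)
  have ev: "\<forall>\<^sub>F h in at_right 0. 0 < h \<and> h < b - a"
    using assms(3) by (auto simp: eventually_at_right_field intro!: exI[of _ "b - a"])
  have "filterlim (\<lambda>h. a + h) (at a within {c..b}) (at_right 0)"
    unfolding filterlim_at using assms
    by (auto intro!: tendsto_eq_intros eventually_mono[OF ev])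
  from filterlim_compose[OF lim this]
  have "((\<lambda>h. (f (a + h) - f a) /\<^sub>R h - D) \<longlongrightarrow> 0) (at_right 0)"
    by (rule Lim_transform_eventually)
      (use ev in \<open>eventually_elim, auto simp: algebra_simps\<close>)
  then show ?thesis by (rule LIM_zero_cancel)
qed

section \<open>Strongly continuous semigroups on a Banach space: bounds, orbits, generator\<close>

locale linear_C0_semigroup =
  fixes S :: "real \<Rightarrow> 'h::banach \<Rightarrow> 'h"
  assumes bounded_linear: "0 \<le> t \<Longrightarrow> bounded_linear (S t)"
    and zero: "S 0 x = x"
    and add: "0 \<le> s \<Longrightarrow> 0 \<le> t \<Longrightarrow> S (s + t) x = S s (S t x)"
    and tendsto_0: "((\<lambda>t. S t x) \<longlongrightarrow> x) (at_right 0)"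
begin

definition gen :: "'h \<Rightarrow> 'h \<Rightarrow> bool" where
  "gen u v \<longleftrightarrow> ((\<lambda>t. (S t u - u) /\<^sub>R t) \<longlongrightarrow> v) (at_right 0)"

lemma diff: "0 \<le> t \<Longrightarrow> S t (x - y) = S t x - S t y"
  and scaleR: "0 \<le> t \<Longrightarrow> S t (c *\<^sub>R x) = c *\<^sub>R S t x"
  and plus: "0 \<le> t \<Longrightarrow> S t (x + y) = S t x + S t y"
  using bounded_linear[of t] by (simp_all add: bounded_linear.axioms linear_diff linear_scale linear_add bounded_linear.linear)

text \<open>The uniform boundedness principle, by Baire's theorem for the sets \<open>F n\<close>.\<close>

lemma bounded_near_0:
  obtains \<delta> K where "\<delta> > 0" "K \<ge> 1" "\<And>t x. 0 \<le> t \<Longrightarrow> t \<le> \<delta> \<Longrightarrow> norm (S t x) \<le> K * norm x"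
proof -
  \<comment> \<open>Right continuity at 0 bounds \<open>S t x\<close> only for times below a
    threshold depending on \<open>x\<close>. Letting the time interval shrink while the bound grows
    puts every \<open>x\<close> into some \<open>F n\<close>.\<close>
  define F where "F n = {x. \<forall>t\<in>{0..inverse (real (Suc n))}. norm (S t x) \<le> real n}" for n
  have closed: "closed (F n)" for n
  proof -
    have "F n = (\<Inter>t\<in>{0..inverse (real (Suc n))}. {x. norm (S t x) \<le> real n})"
      by (auto simp: F_def)
    moreover have "closed {x. norm (S t x) \<le> real n}" if "t \<in> {0..inverse (real (Suc n))}" for t
      using bounded_linear.continuous_on[OF bounded_linear, of t UNIV "\<lambda>x. x"] that
      by (intro closed_Collect_le continuous_intros) auto
    ultimately show ?thesis
      by auto
  qed
  have cover: "\<exists>n. x \<in> F n" for x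
  proof -
    have "\<forall>\<^sub>F t in at_right 0. dist (S t x) x < 1"
      using tendstoD[OF tendsto_0, of 1 x] by simp
    then obtain b where b: "b > 0" "\<And>t. 0 < t \<Longrightarrow> t < b \<Longrightarrow> dist (S t x) x < 1"
      by (auto simp: eventually_at_right_field)
    obtain n1 where n1: "inverse (real (Suc n1)) < b"
      using reals_Archimedean[OF b(1)] by auto
    obtain n2 :: nat where n2: "norm x + 1 \<le> real n2"
      using real_arch_simple by blast
    define n where "n = max n1 n2"
    have "norm (S t x) \<le> real n" if t: "t \<in> {0..inverse (real (Suc n))}" for t
    proof (cases "t = 0")
      case True
      then show ?thesis using n2 by (simp add: zero n_def)
    next
      case False
      have "inverse (real (Suc n)) \<le> inverse (real (Suc n1))"
        by (intro le_imp_inverse_le) (auto simp: n_def)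
      then have "t < b" "0 < t" using t False n1 by (simp_all del: inverse_le_iff_le)
      then have "dist (S t x) x < 1" by (intro b(2))
      then have "norm (S t x) \<le> norm x + 1"
        using norm_triangle_ineq2[of "S t x" x] by (simp add: dist_norm)
      then show ?thesis using n2 by (simp add: n_def)
    qed
    then show ?thesis unfolding F_def by blast
  qed
  \<comment> \<open>If no \<open>F n\<close> had interior points, the complements would be open
    dense sets with empty intersection, contradicting Baire.\<close>
  have "\<exists>n. closure (- F n) \<noteq> UNIV"
  proof (rule ccontr)
    assume "\<not> ?thesis"
    then have dense: "closure (- F n) = UNIV" for n by auto
    have "euclidean closure_of \<Inter>(range (\<lambda>n. - F n)) = topspace (euclidean :: 'h topology)"
    proof (rule Baire_category)
      show "completely_metrizable_space (euclidean :: 'h topology) \<or>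
          locally_compact_space (euclidean :: 'h topology) \<and> regular_space (euclidean :: 'h topology)"
        by (simp add: completely_metrizable_space_euclidean)
    qed (use dense closed in \<open>auto simp: open_Compl\<close>)
    moreover have "\<Inter>(range (\<lambda>n. - F n)) = {}"
      using cover by auto
    ultimately show False by simp
  qed
  then obtain n x0 where "x0 \<notin> closure (- F n)" by auto
  then have "x0 \<in> interior (F n)"
    by (simp add: closure_complement)
  then obtain e where e: "e > 0" "cball x0 e \<subseteq> F n"
    by (meson mem_interior_cball)
  \<comment> \<open>A vector of norm \<open>e\<close> is the difference of two points of the ball in
    \<open>F n\<close>, each sent to norm at most \<open>n\<close>; rescaling gives the factor
    \<open>2 * n / e\<close>. The maximum with 1 makes the powers of \<open>K\<close>
    increasing.\<close>
  define K where "K = max 1 (2 * real n / e)"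
  show ?thesis
  proof (rule that[of "inverse (real (Suc n))" K])
    fix t x assume t: "0 \<le> t" "t \<le> inverse (real (Suc n))"
    show "norm (S t x) \<le> K * norm x"
    proof (cases "x = 0")
      case True
      then show ?thesis
        using linear_0[OF bounded_linear.linear[OF bounded_linear[OF t(1)]]] by simp
    next
      case False
      define y where "y = (e / norm x) *\<^sub>R x"
      have "norm y = e" using False e by (simp add: y_def)
      then have "x0 + y \<in> F n" "x0 \<in> F n"
        using e by (auto intro!: subsetD[OF e(2)] simp: dist_norm)
      then have "norm (S t (x0 + y)) \<le> real n" "norm (S t x0) \<le> real n"
        using t by (auto simp: F_def)
      moreover have "S t y = S t (x0 + y) - S t x0"
        using t by (simp add: plus)
      ultimately have "norm (S t y) \<le> 2 * real n"
        using norm_triangle_ineq4[of "S t (x0 + y)" "S t x0"] by simp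
      then have "e / norm x * norm (S t x) \<le> 2 * real n"
        using t e(1) by (simp add: y_def scaleR)
      then have "norm (S t x) \<le> 2 * real n / e * norm x"
        using False e(1) by (simp add: field_simps)
      also have "\<dots> \<le> K * norm x"
        by (intro mult_right_mono) (auto simp: K_def)
      finally show ?thesis .
    qed
  qed (auto simp: K_def)
qed

text \<open>The semigroup law costs one factor \<open>K\<close> for each time step of length
  \<open>\<delta>\<close>; as \<open>K\<close> is at least 1, shorter times are covered by the same
  power.\<close>

lemma bounded_on_Icc:
  obtains K where "K \<ge> 0" "\<And>t x. 0 \<le> t \<Longrightarrow> t \<le> b \<Longrightarrow> norm (S t x) \<le> K * norm x"
proof -
  obtain \<delta> K where \<delta>: "\<delta> > 0" "K \<ge> 1" "\<And>t x. 0 \<le> t \<Longrightarrow> t \<le> \<delta> \<Longrightarrow> norm (S t x) \<le> K * norm x"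
    using bounded_near_0 by blast
  have *: "0 \<le> t \<Longrightarrow> t \<le> real n * \<delta> \<Longrightarrow> norm (S t x) \<le> K ^ n * norm x" for n t x
  proof (induction n arbitrary: t)
    case 0
    then show ?case by (simp add: zero)
  next
    case (Suc n)
    show ?case
    proof (cases "t \<le> \<delta>")
      case True
      have "norm (S t x) \<le> K ^ 1 * norm x" using \<delta>(3) Suc.prems True by simp
      also have "\<dots> \<le> K ^ Suc n * norm x"
        using \<delta>(2) by (intro mult_right_mono power_increasing) auto
      finally show ?thesis .
    next
      case False
      have "S t x = S \<delta> (S (t - \<delta>) x)" using add[of \<delta> "t - \<delta>" x] False \<delta>(1) by simp
      then have "norm (S t x) \<le> K * norm (S (t - \<delta>) x)" using \<delta>(1,3) by simp
      also have "\<dots> \<le> K * (K ^ n * norm x)"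
        using \<delta>(2) Suc False by (intro mult_left_mono Suc.IH) (auto simp: algebra_simps)
      finally show ?thesis by (simp add: mult.assoc)
    qed
  qed
  obtain n :: nat where "b / \<delta> \<le> real n"
    using real_arch_simple by blast
  then have "b \<le> real n * \<delta>"
    using \<delta>(1) by (simp add: field_simps)
  then show ?thesis
    using \<delta>(2) by (intro that[of "K ^ n"] *) auto
qed

text \<open>Both one-sided limits reduce to right continuity at 0: with \<open>m = min s t\<close>,
  the difference of \<open>S s x\<close> and \<open>S t x\<close> is, up to sign, \<open>S m\<close>
  applied to \<open>S \<bar>s - t\<bar> x - x\<close>. Since \<open>m\<close> varies when
  \<open>s\<close> is below \<open>t\<close>, the operator bound must be uniform on the interval
  from 0 to \<open>t\<close>.\<close>

lemma continuous_on_orbit: "continuous_on {0..} (\<lambda>t. S t x)"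
proof -
  have "((\<lambda>s. S s x) \<longlongrightarrow> S t x) (at t within {0..})" if t: "t \<ge> 0" for t
  proof -
    obtain K where K: "K \<ge> 0" "\<And>s x. 0 \<le> s \<Longrightarrow> s \<le> t \<Longrightarrow> norm (S s x) \<le> K * norm x"
      using bounded_on_Icc[of t] by blast
    have lim: "((\<lambda>h. norm (S h x - x)) \<longlongrightarrow> 0) (at_right 0)"
      by (rule tendsto_norm_zero[OF LIM_zero[OF tendsto_0]])
    have abs: "filterlim (\<lambda>s. \<bar>s - t\<bar>) (at_right 0) (at t within {0..})"
      unfolding filterlim_at
      by (auto simp: eventually_at_filter intro!: tendsto_eq_intros)
    have "((\<lambda>s. S s x - S t x) \<longlongrightarrow> 0) (at t within {0..})"
    proof (rule Lim_null_comparison)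
      show "\<forall>\<^sub>F s in at t within {0..}. norm (S s x - S t x) \<le> K * norm (S \<bar>s - t\<bar> x - x)"
        unfolding eventually_at_filter
      proof (intro always_eventually allI impI)
        fix s assume s: "s \<noteq> t" "s \<in> {0..}"
        define m where "m = min s t"
        have "norm (S s x - S t x) = norm (S m (S \<bar>s - t\<bar> x - x))"
          using s t add[of m "\<bar>s - t\<bar>" x]
          by (cases "s < t") (simp_all add: m_def diff norm_minus_commute)
        also have "\<dots> \<le> K * norm (S \<bar>s - t\<bar> x - x)"
          using s t by (intro K) (auto simp: m_def)
        finally show "norm (S s x - S t x) \<le> K * norm (S \<bar>s - t\<bar> x - x)" .
      qed
      show "((\<lambda>s. K * norm (S \<bar>s - t\<bar> x - x)) \<longlongrightarrow> 0) (at t within {0..})"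
        using tendsto_mult_right_zero[OF filterlim_compose[OF lim abs], of K] by simp
    qed
    then show ?thesis by (rule LIM_zero_cancel)
  qed
  then show ?thesis by (auto simp: continuous_on_def)
qed

lemma gen_commute: "gen u v \<Longrightarrow> 0 \<le> t \<Longrightarrow> gen (S t u) (S t v)"
  unfolding gen_def
proof -
  assume lim: "((\<lambda>t. (S t u - u) /\<^sub>R t) \<longlongrightarrow> v) (at_right 0)" and t: "0 \<le> t"
  have "((\<lambda>h. S t ((S h u - u) /\<^sub>R h)) \<longlongrightarrow> S t v) (at_right 0)"
    by (rule bounded_linear.tendsto[OF bounded_linear[OF t] lim])
  moreover have "\<forall>\<^sub>F h in at_right 0. S t ((S h u - u) /\<^sub>R h) = (S h (S t u) - S t u) /\<^sub>R h"
    unfolding eventually_at_filter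
    using t add[of t _ u] add[of _ t u] by (auto simp: scaleR diff add.commute intro!: always_eventually)
  ultimately show "((\<lambda>h. (S h (S t u) - S t u) /\<^sub>R h) \<longlongrightarrow> S t v) (at_right 0)"
    by (rule Lim_transform_eventually)
qed

text \<open>The derivative is two-sided although \<open>gen\<close> is a limit from the right. The
  difference quotient between \<open>s\<close> and \<open>t\<close> is \<open>S (min s t)\<close>
  applied to the quotient of \<open>u\<close> at time \<open>\<bar>s - t\<bar>\<close>. The uniform
  bound controls the error of that quotient, and continuity of the orbit of \<open>v\<close>
  replaces \<open>S (min s t) v\<close> by \<open>S t v\<close>.\<close>

lemma orbit_has_vector_derivative:
  assumes "gen u v" "0 < t"
  shows "((\<lambda>s. S s u) has_vector_derivative S t v) (at t)"
proof -
  obtain K where K: "K \<ge> 0" "\<And>s x. 0 \<le> s \<Longrightarrow> s \<le> t \<Longrightarrow> norm (S s x) \<le> K * norm x"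
    using bounded_on_Icc[of t] by blast
  define q where "q h = (S h u - u) /\<^sub>R h" for h
  have lim: "((\<lambda>h. norm (q h - v)) \<longlongrightarrow> 0) (at_right 0)"
    using assms(1) unfolding gen_def q_def by (rule tendsto_norm_zero[OF LIM_zero])
  have abs: "filterlim (\<lambda>s. \<bar>s - t\<bar>) (at_right 0) (at t)"
    unfolding filterlim_at by (auto simp: eventually_at_filter intro!: tendsto_eq_intros)
  have "continuous (at t) (\<lambda>s. S s v)"
    using continuous_on_interior[OF continuous_on_orbit, of t v] assms(2)
    by simp
  then have "((\<lambda>s. S s v) \<longlongrightarrow> S t v) (nhds t)"
    using tendsto_at_iff_tendsto_nhds[of "\<lambda>s. S s v" t] by (simp add: isCont_def)
  moreover have "filterlim (\<lambda>s. min s t) (nhds t) (at t)"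
    by (auto intro!: tendsto_eq_intros)
  ultimately have "((\<lambda>s. S (min s t) v) \<longlongrightarrow> S t v) (at t)"
    by (rule filterlim_compose)
  then have lim2: "((\<lambda>s. norm (S (min s t) v - S t v)) \<longlongrightarrow> 0) (at t)"
    by (rule tendsto_norm_zero[OF LIM_zero])
  have "((\<lambda>s. (S s u - S t u) /\<^sub>R (s - t) - S t v) \<longlongrightarrow> 0) (at t)"
  proof (rule Lim_null_comparison)
    have "\<forall>\<^sub>F s in at t. s > 0"
      by (rule order_tendstoD(1)[OF tendsto_ident_at assms(2)])
    moreover have "\<forall>\<^sub>F s in at t. s \<noteq> t"
      by (simp add: eventually_at_filter)
    ultimately show "\<forall>\<^sub>F s in at t. norm ((S s u - S t u) /\<^sub>R (s - t) - S t v)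
        \<le> K * norm (q \<bar>s - t\<bar> - v) + norm (S (min s t) v - S t v)"
    proof eventually_elim
      case s: (elim s)
      define m where "m = min s t"
      have m: "0 \<le> m" "m \<le> t" using s assms(2) by (auto simp: m_def)
      have "(S s u - S t u) /\<^sub>R (s - t) = S m (q \<bar>s - t\<bar>)"
      proof (cases "s < t")
        case True
        then have "m = s" "s + \<bar>s - t\<bar> = t" by (auto simp: m_def)
        then have "S t u = S m (S \<bar>s - t\<bar> u)" "S s u = S m u"
          using s add[of s "\<bar>s - t\<bar>" u] by simp_all
        then have "S m (q \<bar>s - t\<bar>) = inverse (t - s) *\<^sub>R (S t u - S s u)"
          using m True by (simp add: q_def scaleR diff)
        also have "\<dots> = inverse (- (t - s)) *\<^sub>R (S s u - S t u)"
          unfolding inverse_minus_eq by (simp add: scaleR_diff_right)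
        finally show ?thesis by simp
      next
        case False
        then have "m = t" "t + \<bar>s - t\<bar> = s" by (auto simp: m_def)
        then have "S s u = S m (S \<bar>s - t\<bar> u)" "S t u = S m u"
          using assms(2) add[of t "\<bar>s - t\<bar>" u] by simp_all
        then show ?thesis using m False by (simp add: q_def scaleR diff)
      qed
      then have "norm ((S s u - S t u) /\<^sub>R (s - t) - S t v)
        = norm (S m (q \<bar>s - t\<bar> - v) + (S m v - S t v))"
        using m by (simp add: diff)
      also have "\<dots> \<le> norm (S m (q \<bar>s - t\<bar> - v)) + norm (S m v - S t v)"
        by (rule norm_triangle_ineq)
      also have "\<dots> \<le> K * norm (q \<bar>s - t\<bar> - v) + norm (S m v - S t v)"
        using m by (intro add_right_mono K)
      finally show ?case
        by (simp add: m_def)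
    qed
    show "((\<lambda>s. K * norm (q \<bar>s - t\<bar> - v) + norm (S (min s t) v - S t v)) \<longlongrightarrow> 0) (at t)"
      using tendsto_add[OF tendsto_mult_right_zero[OF filterlim_compose[OF lim abs], of K] lim2] by simp
  qed
  then have "((\<lambda>s. norm ((S s u - S t u) /\<^sub>R (s - t) - S t v)) \<longlongrightarrow> 0) (at t)"
    by (rule tendsto_norm_zero)
  then have "((\<lambda>s. norm (S s u - S t u - (s - t) *\<^sub>R S t v) / norm (s - t)) \<longlongrightarrow> 0) (at t)"
  proof (rule Lim_transform_eventually)
    have "norm ((S s u - S t u) /\<^sub>R (s - t) - S t v)
        = norm (S s u - S t u - (s - t) *\<^sub>R S t v) / norm (s - t)" if "s \<noteq> t" for s
    proof -
      have "(S s u - S t u) /\<^sub>R (s - t) - S t v = (S s u - S t u - (s - t) *\<^sub>R S t v) /\<^sub>R (s - t)"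
        using that by (simp add: scaleR_diff_right)
      then show ?thesis by (simp add: divide_inverse mult.commute)
    qed
    then show "\<forall>\<^sub>F s in at t. norm ((S s u - S t u) /\<^sub>R (s - t) - S t v)
        = norm (S s u - S t u - (s - t) *\<^sub>R S t v) / norm (s - t)"
      by (simp add: eventually_at_filter)
  qed
  then show ?thesis
    by (simp add: has_vector_derivative_def has_derivative_iff_norm bounded_linear_scaleR_left)
qed

text \<open>The means of the orbit of \<open>x\<close> over short time intervals belong to the domain of the generator.\<close>

lemma gen_dense:
  assumes "e > 0"
  obtains u v where "gen u v" "norm (u - x) < e"
proof -
  have cont: "continuous_on A (\<lambda>s. S s x)" if "A \<subseteq> {0..}" for A
    using continuous_on_subset[OF continuous_on_orbit that] .
  have "\<forall>\<^sub>F t in at_right 0. dist (S t x) x < e / 2"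
    using tendstoD[OF tendsto_0, of "e / 2" x] assms by simp
  then obtain b where b: "b > 0" "\<And>t. 0 < t \<Longrightarrow> t < b \<Longrightarrow> dist (S t x) x < e / 2"
    by (auto simp: eventually_at_right_field)
  define d where "d = b / 2"
  have d: "d > 0" "\<And>t. 0 \<le> t \<Longrightarrow> t \<le> d \<Longrightarrow> norm (S t x - x) \<le> e / 2"
  proof -
    show "norm (S t x - x) \<le> e / 2" if "0 \<le> t" "t \<le> d" for t
      using b(1) b(2)[of t] that assms by (cases "t = 0") (auto simp: zero dist_norm d_def)
  qed (use b in \<open>auto simp: d_def\<close>)
  define I where "I t = integral {0..t} (\<lambda>s. S s x)" for t
  define u where "u = I d /\<^sub>R d"
  \<comment> \<open>A one-sided derivative suffices, and at \<open>a = 0\<close>, where the orbit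
    starts, only this one can be expected.\<close>
  have deriv: "((\<lambda>h. (I (a + h) - I a) /\<^sub>R h) \<longlongrightarrow> S a x) (at_right 0)" if "0 \<le> a" for a
    unfolding I_def using that
    by (intro tendsto_right_difference_quotient[of _ _ _ 0 "a + 1"]
        integral_has_vector_derivative cont) auto
  \<comment> \<open>Applying \<open>S h\<close> shifts the interval of integration by
    \<open>h\<close>, so \<open>S h u - u\<close> is the increment of \<open>I\<close> at
    \<open>d\<close> minus its increment at \<open>0\<close>, divided by \<open>d\<close>. The limit
    of the quotient is therefore explicit, although \<open>x\<close> itself need not lie in the
    domain.\<close>
  have "((\<lambda>h. ((I (d + h) - I d) /\<^sub>R h - (I (0 + h) - I 0) /\<^sub>R h) /\<^sub>R d)
      \<longlongrightarrow> (S d x - S 0 x) /\<^sub>R d) (at_right 0)"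
    using d(1) by (intro tendsto_intros deriv) auto
  then have "gen u ((S d x - S 0 x) /\<^sub>R d)"
    unfolding gen_def
  proof (rule Lim_transform_eventually)
    have "((I (d + h) - I d) /\<^sub>R h - (I (0 + h) - I 0) /\<^sub>R h) /\<^sub>R d = (S h u - u) /\<^sub>R h"
      if h: "h > 0" for h
    proof -
      have "S h (I d) = integral {0..d} (S h \<circ> (\<lambda>s. S s x))"
        unfolding I_def using h
        by (intro integral_linear[symmetric] integrable_continuous_real cont bounded_linear) auto
      also have "\<dots> = integral {0..d} ((\<lambda>s. S s x) \<circ> (+) h)"
        using h by (intro integral_cong) (auto simp: add)
      also have "\<dots> = integral {h..d + h} (\<lambda>s. S s x)"
        by (subst integral_shift_Icc_real) simp
      also have "\<dots> = I (d + h) - I h"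
        using Henstock_Kurzweil_Integration.integral_combine[where a = 0 and c = h and b = "d + h" and f = "\<lambda>s. S s x"] h d(1)
          integrable_continuous_real[OF cont[of "{0..d + h}"]]
        by (simp add: I_def algebra_simps)
      finally have Su: "S h u = (I (d + h) - I h) /\<^sub>R d"
        using h by (simp add: u_def scaleR)
      have "I 0 = 0" by (simp add: I_def)
      then show ?thesis
        unfolding Su by (simp add: u_def algebra_simps)
    qed
    then show "\<forall>\<^sub>F h in at_right 0. ((I (d + h) - I d) /\<^sub>R h - (I (0 + h) - I 0) /\<^sub>R h) /\<^sub>R d
        = (S h u - u) /\<^sub>R h"
      by (auto simp: eventually_at_filter)
  qed
  moreover have "norm (u - x) < e"
  proof -
    have "I d - d *\<^sub>R x = integral {0..d} (\<lambda>s. S s x - x)"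
      unfolding I_def using d(1)
      by (subst integral_diff) (auto intro!: integrable_continuous_real cont)
    also have "norm \<dots> \<le> e / 2 * (d - 0)"
      using d by (intro integral_bound continuous_intros cont) auto
    finally have le: "norm (I d - d *\<^sub>R x) \<le> e / 2 * d" by simp
    have "norm (u - x) = norm ((I d - d *\<^sub>R x) /\<^sub>R d)"
      using d(1) by (simp add: u_def scaleR_diff_right)
    also have "\<dots> = norm (I d - d *\<^sub>R x) / d"
      using d(1) by (simp add: divide_inverse_commute)
    also have "\<dots> \<le> e / 2"
      using d(1) le by (simp add: field_simps)
    finally have "norm (u - x) \<le> e / 2" .
    then show ?thesis using assms by simp
  qed
  ultimately show ?thesis by (rule that)
qed

end

section \<open>Symmetric dissipative generators: contractivity, self-adjointness, limits of
  orbits\<close>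

locale symmetric_C0_semigroup = linear_C0_semigroup S for S :: "real \<Rightarrow> 'h::{real_inner, banach} \<Rightarrow> 'h" +
  assumes gen_symmetric: "gen u v \<Longrightarrow> gen u' v' \<Longrightarrow> v \<bullet> u' = u \<bullet> v'"
    and gen_dissipative: "gen u v \<Longrightarrow> v \<bullet> u \<le> 0"
begin

lemma continuous_on_comp_orbit:
  "continuous_on A f \<Longrightarrow> (\<And>x. x \<in> A \<Longrightarrow> 0 \<le> f x) \<Longrightarrow> continuous_on A (\<lambda>s. S (f s) x)"
  by (rule continuous_on_compose2[OF continuous_on_orbit]) auto

lemma approx_gen:
  obtains w z where "\<And>n. gen (w n) (z n)" "w \<longlonglongrightarrow> x"
proof -
  have "\<forall>n. \<exists>w z. gen w z \<and> norm (w - x) < inverse (real (Suc n))"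
  proof
    fix n
    show "\<exists>w z. gen w z \<and> norm (w - x) < inverse (real (Suc n))"
      by (rule gen_dense[of "inverse (real (Suc n))" x]) auto
  qed
  then obtain w z where wz: "\<And>n. gen (w n) (z n)" "\<And>n. norm (w n - x) < inverse (real (Suc n))"
    by metis
  have "(\<lambda>n. w n - x) \<longlonglongrightarrow> 0"
    using LIMSEQ_inverse_real_of_nat
    by (rule Lim_null_comparison[rotated]) (use wz(2) in \<open>auto intro!: always_eventually less_imp_le\<close>)
  then show ?thesis
    by (rule that[OF wz(1) LIM_zero_cancel])
qed

text \<open>An orbit starting in the domain of the generator stays there, so dissipativity makes the
  derivative of the squared norm nonpositive at every positive time. Density and boundedness of
  \<open>S t\<close> extend the inequality to all \<open>x\<close>.\<close>

lemma norm_le: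
  assumes "0 \<le> t"
  shows "norm (S t x) \<le> norm x"
proof -
  have *: "norm (S t u) \<le> norm u" if "gen u v" for u v
  proof -
    have "S t u \<bullet> S t u \<le> S 0 u \<bullet> S 0 u"
    proof (rule DERIV_nonpos_imp_decreasing_open[OF assms])
      fix s assume s: "0 < s" "s < t"
      have "((\<lambda>s. S s u \<bullet> S s u) has_vector_derivative S s u \<bullet> S s v + S s v \<bullet> S s u) (at s)"
        by (intro bounded_bilinear.has_vector_derivative[OF bounded_bilinear_inner]
            orbit_has_vector_derivative[OF that s(1)])
      moreover have "S s u \<bullet> S s v + S s v \<bullet> S s u \<le> 0"
        using gen_dissipative[OF gen_commute[OF that, of s]] s by (simp add: inner_commute)
      ultimately show "\<exists>y. ((\<lambda>s. S s u \<bullet> S s u) has_real_derivative y) (at s) \<and> y \<le> 0"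
        by (auto simp: has_real_derivative_iff_has_vector_derivative)
    qed (auto intro!: continuous_intros continuous_on_comp_orbit)
    then show ?thesis by (simp add: zero norm_eq_sqrt_inner)
  qed
  obtain w z where "\<And>n. gen (w n) (z n)" "w \<longlonglongrightarrow> x"
    using approx_gen by blast
  then show ?thesis
    using bounded_linear.tendsto[OF bounded_linear[OF assms] \<open>w \<longlonglongrightarrow> x\<close>] *
    by (intro LIMSEQ_le[of "\<lambda>n. norm (S t (w n))" _ "\<lambda>n. norm (w n)"] tendsto_norm) auto
qed

text \<open>The function \<open>S (t - s) u \<bullet> S s u'\<close> of \<open>s\<close> takes the
  two sides as its values at \<open>s = 0\<close> and \<open>s = t\<close>. Its derivative compares
  the generator on the left factor with the generator on the right factor, and vanishes by symmetry.
  Density removes the restriction to the domain in both arguments.\<close>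

lemma selfadjoint:
  assumes "0 \<le> t"
  shows "S t x \<bullet> y = x \<bullet> S t y"
proof -
  have *: "S t u \<bullet> u' = u \<bullet> S t u'" if g: "gen u v" "gen u' v'" for u v u' v'
  proof (cases "t = 0")
    case False
    then have "0 < t" using assms by simp
    have "S (t - t) u \<bullet> S t u' = S (t - 0) u \<bullet> S 0 u'"
    proof (rule DERIV_isconst_end[OF \<open>0 < t\<close>])
      fix s assume s: "0 < s" "s < t"
      have "((\<lambda>s. S (t - s) u) has_vector_derivative (-1) *\<^sub>R S (t - s) v) (at s)"
      proof -
        have "((\<lambda>s. t - s) has_vector_derivative -1) (at s)"
          by (auto intro!: derivative_eq_intros)
        moreover have "((\<lambda>s. S s u) has_vector_derivative S (t - s) v) (at (t - s))"
          using s by (intro orbit_has_vector_derivative[OF g(1)]) simp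
        ultimately show ?thesis
          using vector_diff_chain_at[of "\<lambda>s. t - s" "-1" s "\<lambda>s. S s u" "S (t - s) v"]
          by (simp add: o_def)
      qed
      moreover have "((\<lambda>s. S s u') has_vector_derivative S s v') (at s)"
        by (rule orbit_has_vector_derivative[OF g(2) s(1)])
      ultimately have "((\<lambda>s. S (t - s) u \<bullet> S s u') has_vector_derivative
          S (t - s) u \<bullet> S s v' + ((-1) *\<^sub>R S (t - s) v) \<bullet> S s u') (at s)"
        by (intro bounded_bilinear.has_vector_derivative[OF bounded_bilinear_inner])
      moreover have "S (t - s) u \<bullet> S s v' = S (t - s) v \<bullet> S s u'"
        using s gen_symmetric[OF gen_commute[OF g(1), of "t - s"] gen_commute[OF g(2), of s]] by simp
      ultimately show "((\<lambda>s. S (t - s) u \<bullet> S s u') has_real_derivative 0) (at s)"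
        by (simp add: has_real_derivative_iff_has_vector_derivative)
    qed (auto intro!: continuous_intros continuous_on_comp_orbit)
    then show ?thesis by (simp add: zero)
  qed (simp add: zero)
  obtain w z where w: "\<And>n. gen (w n) (z n)" "w \<longlonglongrightarrow> x"
    using approx_gen by blast
  obtain w' z' where w': "\<And>n. gen (w' n) (z' n)" "w' \<longlonglongrightarrow> y"
    using approx_gen by blast
  have "(\<lambda>n. S t (w n) \<bullet> w' n) \<longlonglongrightarrow> S t x \<bullet> y" "(\<lambda>n. w n \<bullet> S t (w' n)) \<longlonglongrightarrow> x \<bullet> S t y"
    using w w' bounded_linear.tendsto[OF bounded_linear[OF assms]]
    by (auto intro!: tendsto_inner)
  moreover have "(\<lambda>n. S t (w n) \<bullet> w' n) = (\<lambda>n. w n \<bullet> S t (w' n))"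
    using * w(1) w'(1) by blast
  ultimately show ?thesis by (simp add: LIMSEQ_unique)
qed

text \<open>Self-adjointness turns \<open>S a x \<bullet> S b x\<close> into
  \<open>S (a + b) x \<bullet> x\<close>, so the Cauchy property of the orbit is decided by one
  scalar function of time.\<close>

lemma norm_diff_orbit_square:
  assumes "0 \<le> s" "0 \<le> t"
  shows "(norm (S s x - S t x))\<^sup>2 = S (2 * s) x \<bullet> x + S (2 * t) x \<bullet> x - 2 * (S (s + t) x \<bullet> x)"
proof -
  have "S a x \<bullet> S b x = S (a + b) x \<bullet> x" if "0 \<le> a" "0 \<le> b" for a b
    using that selfadjoint[of b "S a x" x] add[of b a x] by (simp add: add.commute)
  then have "S s x \<bullet> S s x = S (2 * s) x \<bullet> x" "S t x \<bullet> S t x = S (2 * t) x \<bullet> x"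
      "S s x \<bullet> S t x = S (s + t) x \<bullet> x"
    using assms by (simp_all only: mult_2)
  moreover have "(norm (a - b))\<^sup>2 = a \<bullet> a + b \<bullet> b - 2 * (a \<bullet> b)" for a b :: 'h
    by (simp add: power2_norm_eq_inner inner_diff_left inner_diff_right inner_commute[of b a])
  ultimately show ?thesis by simp
qed

text \<open>By self-adjointness \<open>\<langle>S t x, x\<rangle> = \<parallel>S (t/2) x\<parallel>\<^sup>2\<close> decreases to a limit, which makes the orbit
  Cauchy.\<close>

theorem orbit_converges:
  obtains h where "((\<lambda>t. S t x) \<longlongrightarrow> h) at_top" "\<And>s. 0 \<le> s \<Longrightarrow> S s h = h"
    "\<And>k. (\<And>s. 0 \<le> s \<Longrightarrow> S s k = k) \<Longrightarrow> h \<bullet> k = x \<bullet> k"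
proof -
  define a where "a t = S t x \<bullet> x" for t
  have a_eq: "a t = (norm (S (t / 2) x))\<^sup>2" if "0 \<le> t" for t
    using that selfadjoint[of "t / 2" "S (t / 2) x" x] add[of "t / 2" "t / 2" x]
    by (simp add: a_def power2_norm_eq_inner)
  have a_mono: "a t \<le> a s" if "0 \<le> s" "s \<le> t" for s t
  proof -
    have "norm (S (t / 2) x) \<le> norm (S (s / 2) x)"
      using that norm_le[of "(t - s) / 2" "S (s / 2) x"] add[of "(t - s) / 2" "s / 2" x]
      by (simp flip: add_divide_distrib)
    then show ?thesis using that by (simp add: a_eq power_mono)
  qed
  define l where "l = (INF t\<in>{0..}. a t)"
  have bdd: "bdd_below (a ` {0..})"
    by (rule bdd_belowI2[of _ 0]) (simp add: a_eq)
  have l_le: "l \<le> a t" if "0 \<le> t" for t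
    unfolding l_def using that by (intro cINF_lower bdd) auto
  have cauchy: "\<exists>N\<ge>0. \<forall>s\<ge>N. \<forall>t\<ge>N. norm (S s x - S t x) < e" if "e > 0" for e :: real
  proof -
    have "l < l + e\<^sup>2 / 2" using that by simp
    then obtain N where N: "0 \<le> N" "a N < l + e\<^sup>2 / 2"
      \<comment> \<open>From time \<open>N\<close> on, the scalar function lies between its infimum
        \<open>l\<close> and \<open>l + e\<^sup>2 / 2\<close>. In the formula for the squared
        distance the two positive terms are at most \<open>a N\<close> and the subtracted one is at
        least \<open>l\<close> twice, which leaves less than \<open>e\<^sup>2\<close>.\<close>
      unfolding l_def by (subst (asm) cINF_less_iff[OF _ bdd]) auto
    have "norm (S s x - S t x) < e" if st: "s \<ge> N" "t \<ge> N" for s t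
    proof -
      have "(norm (S s x - S t x))\<^sup>2 = a (2 * s) + a (2 * t) - 2 * a (s + t)"
        using N st unfolding a_def by (intro norm_diff_orbit_square) auto
      also have "\<dots> \<le> a N + a N - 2 * l"
        using N st l_le[of "s + t"] a_mono[of N "2 * s"] a_mono[of N "2 * t"] by simp
      also have "\<dots> < e\<^sup>2" using N by simp
      finally show ?thesis using \<open>e > 0\<close> by (simp add: power_less_imp_less_base)
    qed
    then show ?thesis using N by blast
  qed
  \<comment> \<open>Completeness is available for sequences, so the limit is found along integer
    times; the Cauchy estimate for real times then carries it over to all times.\<close>
  have "Cauchy (\<lambda>n. S (real n) x)"
  proof (rule CauchyI)
    fix e :: real assume "e > 0"
    then obtain N where N: "\<forall>s\<ge>N. \<forall>t\<ge>N. norm (S s x - S t x) < e"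
      using cauchy by blast
    obtain M :: nat where M: "N \<le> real M" using real_arch_simple by blast
    have "N \<le> real m" if "m \<ge> M" for m
      using M that by linarith
    then show "\<exists>M. \<forall>m\<ge>M. \<forall>n\<ge>M. norm (S (real m) x - S (real n) x) < e"
      using N by blast
  qed
  then obtain h where h: "(\<lambda>n. S (real n) x) \<longlonglongrightarrow> h"
    using Cauchy_convergent convergent_def by blast
  have lim: "((\<lambda>t. S t x) \<longlongrightarrow> h) at_top"
  proof (rule tendstoI)
    fix e :: real assume "e > 0"
    then obtain N where N: "0 \<le> N" "\<forall>s\<ge>N. \<forall>t\<ge>N. norm (S s x - S t x) < e / 2"
      using cauchy[of "e / 2"] by auto
    obtain M :: nat where M: "N \<le> real M" using real_arch_simple by blast
    have "dist (S t x) h < e" if "t \<ge> N" for t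
    proof -
      have "norm (S t x - h) \<le> e / 2"
      proof (rule LIMSEQ_le_const2[of "\<lambda>n. norm (S t x - S (real n) x)"])
        show "(\<lambda>n. norm (S t x - S (real n) x)) \<longlonglongrightarrow> norm (S t x - h)"
          by (intro tendsto_intros h)
        have "N \<le> real n" if "n \<ge> M" for n
          using M that by linarith
        then show "\<exists>M. \<forall>n\<ge>M. norm (S t x - S (real n) x) \<le> e / 2"
          using N(2) that less_imp_le by blast
      qed
      then show ?thesis using \<open>e > 0\<close> by (simp add: dist_norm)
    qed
    then show "\<forall>\<^sub>F t in at_top. dist (S t x) h < e"
      by (auto simp: eventually_at_top_linorder)
  qed
  moreover have "S s h = h" if "0 \<le> s" for s
  proof (rule tendsto_unique[OF trivial_limit_at_top_linorder])
    show "((\<lambda>t. S s (S t x)) \<longlongrightarrow> S s h) at_top"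
      by (rule bounded_linear.tendsto[OF bounded_linear[OF that] lim])
    have "filterlim (\<lambda>t. s + t) at_top at_top"
      by (rule filterlim_tendsto_add_at_top[OF tendsto_const filterlim_ident])
    from filterlim_compose[OF lim this]
    have "((\<lambda>t. S (s + t) x) \<longlongrightarrow> h) at_top" .
    moreover have "\<forall>\<^sub>F t in at_top. S (s + t) x = S s (S t x)"
      using eventually_ge_at_top[of 0] by eventually_elim (simp add: add that)
    ultimately show "((\<lambda>t. S s (S t x)) \<longlongrightarrow> h) at_top"
      by (rule Lim_transform_eventually)
  qed
  \<comment> \<open>Together with the invariance of \<open>h\<close>, this identifies
    \<open>h\<close> as the orthogonal projection of \<open>x\<close> onto the fixed
    vectors.\<close>
  moreover have "h \<bullet> k = x \<bullet> k" if k: "\<And>s. 0 \<le> s \<Longrightarrow> S s k = k" for k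
  proof (rule tendsto_unique[OF trivial_limit_at_top_linorder])
    show "((\<lambda>t. S t x \<bullet> k) \<longlongrightarrow> h \<bullet> k) at_top" by (intro tendsto_intros lim)
    have "\<forall>\<^sub>F t in at_top. x \<bullet> k = S t x \<bullet> k"
      using eventually_ge_at_top[of 0] by eventually_elim (simp add: selfadjoint k)
    then show "((\<lambda>t. S t x \<bullet> k) \<longlongrightarrow> x \<bullet> k) at_top"
      by (rule Lim_transform_eventually[OF tendsto_const])
  qed
  ultimately show ?thesis by (rule that)
qed

end

section \<open>Completeness of \<open>L\<^sup>2\<close>\<close>

lemma L2_measurable: "f \<in> L2 M \<Longrightarrow> f \<in> borel_measurable M"
  and L2_integrable_square: "f \<in> L2 M \<Longrightarrow> integrable M (\<lambda>x. (norm (f x))\<^sup>2)"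
  by (simp_all add: L2_def)

lemma L2_zero [simp]: "(\<lambda>x. 0) \<in> L2 M"
  by (simp add: L2_def)

lemma L2_scale: "f \<in> L2 M \<Longrightarrow> (\<lambda>x. c * f x) \<in> L2 M"
  by (auto simp: L2_def norm_mult power_mult_distrib)

lemma L2_add:
  assumes "f \<in> L2 M" "g \<in> L2 M"
  shows "(\<lambda>x. f x + g x) \<in> L2 M"
proof -
  note [measurable] = assms[THEN L2_measurable]
  have bound: "(norm (f x + g x))\<^sup>2 \<le> 2 * (norm (f x))\<^sup>2 + 2 * (norm (g x))\<^sup>2" for x
  proof -
    have "(norm (f x + g x))\<^sup>2 \<le> (norm (f x) + norm (g x))\<^sup>2"
      by (intro power_mono norm_triangle_ineq) auto
    also have "\<dots> \<le> 2 * (norm (f x))\<^sup>2 + 2 * (norm (g x))\<^sup>2"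
      using sum_squares_bound[of "norm (f x)" "norm (g x)"] by (simp add: power2_sum)
    finally show ?thesis .
  qed
  have "integrable M (\<lambda>x. 2 * (norm (f x))\<^sup>2 + 2 * (norm (g x))\<^sup>2)"
    by (simp add: L2_integrable_square assms)
  then have "integrable M (\<lambda>x. (norm (f x + g x))\<^sup>2)"
  proof (rule Bochner_Integration.integrable_bound)
    show "AE x in M. norm ((norm (f x + g x))\<^sup>2) \<le> norm (2 * (norm (f x))\<^sup>2 + 2 * (norm (g x))\<^sup>2)"
      using order_trans[OF bound abs_ge_self] by (simp only: real_norm_def abs_power2 AE_I2)
  qed measurable
  then show ?thesis by (simp add: L2_def)
qed

lemma L2_diff: "f \<in> L2 M \<Longrightarrow> g \<in> L2 M \<Longrightarrow> (\<lambda>x. f x - g x) \<in> L2 M"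
  using L2_add[of f M "\<lambda>x. - 1 * g x"] L2_scale[of g M "-1"] by simp

lemma L2_uminus: "f \<in> L2 M \<Longrightarrow> (\<lambda>x. - f x) \<in> L2 M"
  using L2_scale[of f M "-1"] by simp

lemma borel_measurable_cnj:
  "g \<in> borel_measurable M \<Longrightarrow> (\<lambda>x. cnj (g x)) \<in> borel_measurable M"
  by (rule measurable_compose[OF _ borel_measurable_continuous_onI]) (auto intro: continuous_intros)

lemma L2_mult_integrable:
  assumes "f \<in> L2 M" "g \<in> L2 M"
  shows "integrable M (\<lambda>x. f x * cnj (g x))"
proof -
  note [measurable] = assms[THEN L2_measurable]
  have bound: "norm (f x * cnj (g x)) \<le> (norm (f x))\<^sup>2 + (norm (g x))\<^sup>2" for x
  proof -
    have "0 \<le> norm (f x) * norm (g x)" by simp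
    then have "norm (f x) * norm (g x) \<le> (norm (f x))\<^sup>2 + (norm (g x))\<^sup>2"
      using sum_squares_bound[of "norm (f x)" "norm (g x)"] by linarith
    then show ?thesis by (simp add: norm_mult)
  qed
  have "integrable M (\<lambda>x. (norm (f x))\<^sup>2 + (norm (g x))\<^sup>2)"
    by (simp add: L2_integrable_square assms)
  then show ?thesis
  proof (rule Bochner_Integration.integrable_bound)
    show "AE x in M. norm (f x * cnj (g x)) \<le> norm ((norm (f x))\<^sup>2 + (norm (g x))\<^sup>2)"
      using order_trans[OF bound abs_ge_self] by (simp only: real_norm_def AE_I2)
    show "(\<lambda>x. f x * cnj (g x)) \<in> borel_measurable M"
      by (intro borel_measurable_times borel_measurable_cnj) measurable
  qed
qed

lemma L2_inner_self: "L2_inner M f f = of_real (\<integral>x. (norm (f x))\<^sup>2 \<partial>M)"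
  unfolding L2_inner_def by (simp flip: complex_norm_square of_real_power integral_complex_of_real)

lemma L2_inner_commute: "L2_inner M g f = cnj (L2_inner M f g)"
  unfolding L2_inner_def by (simp add: mult.commute flip: Bochner_Integration.integral_cnj)

lemma L2_norm_eq_inner: "L2_norm M f = sqrt (Re (L2_inner M f f))"
  by (simp add: L2_inner_self L2_norm_def)

lemma L2_norm_nonneg [simp]: "0 \<le> L2_norm M f"
  by (simp add: L2_norm_def)

lemma L2_norm_eq_0:
  assumes "f \<in> L2 M"
  shows "L2_norm M f = 0 \<longleftrightarrow> (AE x in M. f x = 0)"
  using integral_nonneg_eq_0_iff_AE[OF L2_integrable_square[OF assms]] by (simp add: L2_norm_def)

text \<open>Riesz--Fischer: a subsequence with summable \<open>4\<^sup>k \<parallel>f (r (k + 1)) - f (r k)\<parallel>\<^sup>2\<close> converges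
  almost everywhere, and the limit is the limit in norm by Fatou's lemma.\<close>

theorem L2_complete:
  fixes f :: "nat \<Rightarrow> 'a \<Rightarrow> complex"
  assumes f: "\<And>n. f n \<in> L2 M"
    and Cauchy: "\<And>e. 0 < e \<Longrightarrow> \<exists>N. \<forall>m\<ge>N. \<forall>n\<ge>N. L2_norm M (\<lambda>x. f m x - f n x) < e"
  obtains g where "g \<in> L2 M" "(\<lambda>n. L2_norm M (\<lambda>x. f n x - g x)) \<longlonglongrightarrow> 0"
proof -
  note [measurable] = f[THEN L2_measurable]
  have "\<exists>N. \<forall>m\<ge>N. \<forall>n\<ge>N. L2_norm M (\<lambda>x. f m x - f n x) < (1/4) ^ k" for k
    by (rule Cauchy) simp
  then have "\<forall>k. \<exists>N. \<forall>m\<ge>N. \<forall>n\<ge>N. L2_norm M (\<lambda>x. f m x - f n x) < (1/4) ^ k" ..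
  from choice[OF this] obtain N
    where N: "L2_norm M (\<lambda>x. f m x - f n x) < (1/4) ^ k" if "m \<ge> N k" "n \<ge> N k" for k m n
    by blast
  \<comment> \<open>The sum makes \<open>r\<close> monotone and at least \<open>N k\<close>; the
    summand \<open>k\<close> makes it unbounded, so that \<open>r\<close> indexes a subsequence
    reaching beyond every bound.\<close>
  define r where "r k = (\<Sum>i\<le>k. N i) + k" for k
  have "N k \<le> (\<Sum>i\<le>k. N i)" for k
    by (rule member_le_sum) auto
  then have r_ge: "N k \<le> r k" "k \<le> r k" for k
    by (simp_all add: r_def trans_le_add1)
  have r_Suc: "r k \<le> r (Suc k)" for k
    by (simp add: r_def)
  define d where "d k x = f (r (Suc k)) x - f (r k) x" for k x
  have [measurable]: "d k \<in> borel_measurable M" for k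
    unfolding d_def by measurable
  have d_L2: "d k \<in> L2 M" for k
    unfolding d_def[abs_def] by (intro L2_diff f)
  have nn_eq: "(\<integral>\<^sup>+x. ennreal ((norm (h x))\<^sup>2) \<partial>M) = ennreal ((L2_norm M h)\<^sup>2)" if "h \<in> L2 M" for h
    using that by (subst nn_integral_eq_integral) (auto simp: L2_def L2_norm_def)
  \<comment> \<open>The norm of \<open>d k\<close> is below \<open>(1/4) ^ k\<close>, so the weight
    \<open>4 ^ k\<close> still leaves a summable series of integrals. Where the weighted series is
    finite its terms are bounded, and the weight turns this into geometric decay of
    \<open>d k x\<close>.\<close>
  have "(\<integral>\<^sup>+x. (\<Sum>k. ennreal (4 ^ k * (norm (d k x))\<^sup>2)) \<partial>M)
      = (\<Sum>k. \<integral>\<^sup>+x. ennreal (4 ^ k * (norm (d k x))\<^sup>2) \<partial>M)"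
    by (rule nn_integral_suminf) simp
  also have "\<dots> \<le> (\<Sum>k. ennreal ((1/2) ^ k))"
  proof (rule suminf_le)
    fix k
    have "L2_norm M (d k) < (1/4) ^ k"
      unfolding d_def by (intro N) (use r_ge[of k] r_Suc[of k] in auto)
    then have "(L2_norm M (d k))\<^sup>2 \<le> ((1/4) ^ k)\<^sup>2"
      by (intro power_mono) auto
    also have "\<dots> = (1/16) ^ k"
      by (simp add: power2_eq_square flip: power_mult_distrib)
    also have "\<dots> \<le> (1/8) ^ k"
      by (intro power_mono) auto
    finally have le: "(L2_norm M (d k))\<^sup>2 \<le> (1/8) ^ k" .
    have "(\<integral>\<^sup>+x. ennreal (4 ^ k * (norm (d k x))\<^sup>2) \<partial>M) = ennreal (4 ^ k * (L2_norm M (d k))\<^sup>2)"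
      by (simp add: ennreal_mult nn_integral_cmult nn_eq[OF d_L2])
    also have "\<dots> \<le> ennreal (4 ^ k * (1/8) ^ k)"
      using le by (intro ennreal_leI mult_left_mono) auto
    also have "4 ^ k * (1/8) ^ k = ((1/2) ^ k :: real)"
      by (simp flip: power_mult_distrib)
    finally show "(\<integral>\<^sup>+x. ennreal (4 ^ k * (norm (d k x))\<^sup>2) \<partial>M) \<le> ennreal ((1/2) ^ k)" .
  qed auto
  also have "\<dots> < \<infinity>"
    by (subst suminf_ennreal2) auto
  finally have "AE x in M. (\<Sum>k. ennreal (4 ^ k * (norm (d k x))\<^sup>2)) \<noteq> \<infinity>"
    by (intro nn_integral_PInf_AE) auto
  then have conv: "AE x in M. convergent (\<lambda>k. f (r k) x)"
  proof eventually_elim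
    case (elim x)
    then have "summable (\<lambda>k. 4 ^ k * (norm (d k x))\<^sup>2)"
      by (intro summable_suminf_not_top) auto
    then have "Bseq (\<lambda>k. 4 ^ k * (norm (d k x))\<^sup>2)"
      by (intro convergent_imp_Bseq summable_LIMSEQ_zero[THEN convergentI])
    then obtain C where C: "C > 0" "\<And>k. 4 ^ k * (norm (d k x))\<^sup>2 \<le> C"
      by (auto simp: Bseq_def)
    have bound: "norm (d k x) \<le> sqrt C * (1/2) ^ k" for k
    proof (rule power2_le_imp_le)
      have "((1/2) ^ k)\<^sup>2 = (1/4 :: real) ^ k"
        by (simp add: power2_eq_square flip: power_mult_distrib)
      also have "\<dots> = inverse (4 ^ k)"
        by (simp add: power_one_over inverse_eq_divide)
      finally show "(norm (d k x))\<^sup>2 \<le> (sqrt C * (1/2) ^ k)\<^sup>2"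
        using C by (simp add: power_mult_distrib field_simps)
    qed (use C in auto)
    have "summable (\<lambda>k. d k x)"
      by (rule summable_comparison_test[OF _ summable_mult[OF summable_geometric[of "1/2"]]])
        (use bound in auto)
    then have "convergent (\<lambda>n. f (r 0) x + (\<Sum>k<n. d k x))"
      by (intro convergent_add convergent_const) (simp add: summable_iff_convergent)
    moreover have "f (r 0) x + (\<Sum>k<n. d k x) = f (r n) x" for n
      using sum_lessThan_telescope[of "\<lambda>k. f (r k) x" n] by (simp add: d_def)
    ultimately show ?case by simp
  qed
  define g where "g x = lim (\<lambda>k. f (r k) x)" for x
  have [measurable]: "g \<in> borel_measurable M"
    unfolding g_def by measurable
  \<comment> \<open>The nonnegative integral is used because \<open>f n - g\<close> is not yet known
    to lie in \<open>L2 M\<close>, and \<open>L2_norm\<close> would give the value 0 to a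
    nonintegrable square. The estimate yields both the membership and the norm bound.\<close>
  have fatou: "(\<integral>\<^sup>+x. ennreal ((norm (f n x - g x))\<^sup>2) \<partial>M) \<le> ennreal (e\<^sup>2)"
    if n: "\<And>m. m \<ge> K \<Longrightarrow> L2_norm M (\<lambda>x. f n x - f m x) \<le> e" for n K e
  proof -
    have "(\<integral>\<^sup>+x. ennreal ((norm (f n x - g x))\<^sup>2) \<partial>M)
        = (\<integral>\<^sup>+x. liminf (\<lambda>k. ennreal ((norm (f n x - f (r k) x))\<^sup>2)) \<partial>M)"
    proof (rule nn_integral_cong_AE)
      show "AE x in M. ennreal ((norm (f n x - g x))\<^sup>2) = liminf (\<lambda>k. ennreal ((norm (f n x - f (r k) x))\<^sup>2))"
        using conv
      proof eventually_elim
        case (elim x)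
        then have "(\<lambda>k. f (r k) x) \<longlonglongrightarrow> g x"
          unfolding g_def by (simp add: convergent_LIMSEQ_iff)
        then have "(\<lambda>k. ennreal ((norm (f n x - f (r k) x))\<^sup>2)) \<longlonglongrightarrow> ennreal ((norm (f n x - g x))\<^sup>2)"
          by (intro tendsto_intros)
        then show ?case
          by (intro lim_imp_Liminf[symmetric]) auto
      qed
    qed
    also have "\<dots> \<le> liminf (\<lambda>k. \<integral>\<^sup>+x. ennreal ((norm (f n x - f (r k) x))\<^sup>2) \<partial>M)"
      by (rule nn_integral_liminf) measurable
    also have "\<dots> \<le> ennreal (e\<^sup>2)"
    proof (rule Liminf_le)
      have "(\<integral>\<^sup>+x. ennreal ((norm (f n x - f (r k) x))\<^sup>2) \<partial>M) \<le> ennreal (e\<^sup>2)" if "k \<ge> K" for k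
        using n[of "r k"] r_ge(2)[of k] that L2_diff[OF f f]
        by (subst nn_eq) (auto intro!: ennreal_leI power_mono)
      then show "\<forall>\<^sub>F k in sequentially. (\<integral>\<^sup>+x. ennreal ((norm (f n x - f (r k) x))\<^sup>2) \<partial>M) \<le> ennreal (e\<^sup>2)"
        by (auto simp: eventually_sequentially)
    qed auto
    finally show ?thesis .
  qed
  have diff_L2: "(\<lambda>x. f n x - g x) \<in> L2 M" "L2_norm M (\<lambda>x. f n x - g x) \<le> e"
    if "\<And>m. m \<ge> K \<Longrightarrow> L2_norm M (\<lambda>x. f n x - f m x) \<le> e" for n K e
  proof -
    note le = fatou[OF that]
    show L2: "(\<lambda>x. f n x - g x) \<in> L2 M"
      using le_less_trans[OF le ennreal_less_top] by (auto simp: L2_def integrable_iff_bounded)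
    have "0 \<le> e"
      using that[of K] order_trans[OF L2_norm_nonneg] by blast
    moreover have "(L2_norm M (\<lambda>x. f n x - g x))\<^sup>2 \<le> e\<^sup>2"
      using le by (subst (asm) nn_eq[OF L2]) (simp add: ennreal_le_iff)
    ultimately show "L2_norm M (\<lambda>x. f n x - g x) \<le> e"
      by (rule power2_le_imp_le[rotated])
  qed
  show ?thesis
  proof
    obtain K where K: "\<forall>m\<ge>K. \<forall>n\<ge>K. L2_norm M (\<lambda>x. f m x - f n x) < 1"
      using Cauchy[OF zero_less_one] by blast
    then have "L2_norm M (\<lambda>x. f K x - f m x) \<le> 1" if "m \<ge> K" for m
      using that by (simp add: less_imp_le)
    from L2_diff[OF f[of K] diff_L2(1)[where K = K, OF this]] show "g \<in> L2 M" by simp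
    show "(\<lambda>n. L2_norm M (\<lambda>x. f n x - g x)) \<longlonglongrightarrow> 0"
    proof (rule LIMSEQ_I)
      fix e :: real assume e: "e > 0"
      obtain K where K: "\<forall>m\<ge>K. \<forall>n\<ge>K. L2_norm M (\<lambda>x. f m x - f n x) < e / 2"
        using Cauchy[OF half_gt_zero[OF e]] by blast
      have "L2_norm M (\<lambda>x. f n x - g x) < e" if n: "n \<ge> K" for n
      proof -
        have "L2_norm M (\<lambda>x. f n x - f m x) \<le> e / 2" if "m \<ge> K" for m
          using K n that by (simp add: less_imp_le)
        from diff_L2(2)[where K = K, OF this] e show ?thesis by simp
      qed
      then show "\<exists>K. \<forall>n\<ge>K. norm (L2_norm M (\<lambda>x. f n x - g x) - 0) < e"
        by auto
    qed
  qed
qed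

text \<open>\<open>L\<^sup>2\<close> of Lebesgue measure as a type: every \<open>L\<^sup>2\<close> space with a positive density \<open>\<mu>\<close> is
  carried onto it by multiplication with \<open>\<surd>\<mu>\<close>.\<close>

quotient_type (overloaded) 'a lebesgue_L2 = "'a::euclidean_space \<Rightarrow> complex" /
  partial: "\<lambda>f g. f \<in> L2 lborel \<and> g \<in> L2 lborel \<and> (AE x in lborel. f x = g x)"
proof (rule part_equivpI)
  show "transp (\<lambda>f g. f \<in> L2 (lborel :: 'a measure) \<and> g \<in> L2 lborel \<and> (AE x in lborel. f x = g x))"
    by (intro transpI) auto
qed (auto intro!: exI[of _ "\<lambda>x. 0"] sympI)

text \<open>The product is the real part of the complex one, which makes the quotient a real Hilbert
  space and so admits the abstract semigroup theory. The norm is the complex \<open>L2\<close> norm,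
  so nothing is lost for convergence.\<close>

instantiation lebesgue_L2 :: (euclidean_space) real_inner
begin

lift_definition zero_lebesgue_L2 :: "'a lebesgue_L2" is "\<lambda>x. 0" by simp

lift_definition plus_lebesgue_L2 :: "'a lebesgue_L2 \<Rightarrow> 'a lebesgue_L2 \<Rightarrow> 'a lebesgue_L2"
  is "\<lambda>f g x. f x + g x" by (auto intro: L2_add)

lift_definition minus_lebesgue_L2 :: "'a lebesgue_L2 \<Rightarrow> 'a lebesgue_L2 \<Rightarrow> 'a lebesgue_L2"
  is "\<lambda>f g x. f x - g x" by (auto intro: L2_diff)

lift_definition uminus_lebesgue_L2 :: "'a lebesgue_L2 \<Rightarrow> 'a lebesgue_L2"
  is "\<lambda>f x. - f x" by (auto intro: L2_uminus)

lift_definition scaleR_lebesgue_L2 :: "real \<Rightarrow> 'a lebesgue_L2 \<Rightarrow> 'a lebesgue_L2"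
  is "\<lambda>c f x. of_real c * f x" by (auto intro: L2_scale)

lift_definition inner_lebesgue_L2 :: "'a lebesgue_L2 \<Rightarrow> 'a lebesgue_L2 \<Rightarrow> real"
  is "\<lambda>f g. Re (L2_inner lborel f g)"
proof -
  fix f f' g g' :: "'a \<Rightarrow> complex"
  assume f: "f \<in> L2 lborel \<and> f' \<in> L2 lborel \<and> (AE x in lborel. f x = f' x)"
    and g: "g \<in> L2 lborel \<and> g' \<in> L2 lborel \<and> (AE x in lborel. g x = g' x)"
  have "AE x in lborel. f x * cnj (g x) = f' x * cnj (g' x)"
    using f[THEN conjunct2, THEN conjunct2] g[THEN conjunct2, THEN conjunct2]
    by eventually_elim simp
  moreover have "(\<lambda>x. f x * cnj (g x)) \<in> borel_measurable lborel"
      "(\<lambda>x. f' x * cnj (g' x)) \<in> borel_measurable lborel"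
    using f g L2_mult_integrable borel_measurable_integrable by blast+
  ultimately have "L2_inner lborel f g = L2_inner lborel f' g'"
    unfolding L2_inner_def by (intro integral_cong_AE)
  then show "Re (L2_inner lborel f g) = Re (L2_inner lborel f' g')" by simp
qed

definition norm_lebesgue_L2 :: "'a lebesgue_L2 \<Rightarrow> real"
  where "norm_lebesgue_L2 x = sqrt (x \<bullet> x)"

definition dist_lebesgue_L2 :: "'a lebesgue_L2 \<Rightarrow> 'a lebesgue_L2 \<Rightarrow> real"
  where "dist_lebesgue_L2 x y = norm (x - y)"

definition sgn_lebesgue_L2 :: "'a lebesgue_L2 \<Rightarrow> 'a lebesgue_L2"
  where "sgn_lebesgue_L2 x = scaleR (inverse (norm x)) x"

definition uniformity_lebesgue_L2 :: "('a lebesgue_L2 \<times> 'a lebesgue_L2) filter"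
  where "uniformity_lebesgue_L2 = (INF e\<in>{0 <..}. principal {(x, y). dist x y < e})"

definition open_lebesgue_L2 :: "'a lebesgue_L2 set \<Rightarrow> bool"
  where "open_lebesgue_L2 U \<longleftrightarrow> (\<forall>x\<in>U. eventually (\<lambda>(x', y). x' = x \<longrightarrow> y \<in> U) uniformity)"

instance
proof
  fix x y z :: "'a lebesgue_L2" and a b :: real
  show "x + y + z = x + (y + z)" by transfer (auto simp: add.assoc intro!: L2_add)
  show "x + y = y + x" by transfer (auto simp: add.commute intro!: L2_add)
  show "0 + x = x" by transfer auto
  show "- x + x = 0" by transfer auto
  show "x - y = x + - y" by transfer (auto intro!: L2_diff)
  show "a *\<^sub>R (x + y) = a *\<^sub>R x + a *\<^sub>R y"
    by transfer (auto simp: distrib_left intro!: L2_add L2_scale)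
  show "(a + b) *\<^sub>R x = a *\<^sub>R x + b *\<^sub>R x"
    by transfer (auto simp: distrib_right intro!: L2_add L2_scale)
  show "a *\<^sub>R b *\<^sub>R x = (a * b) *\<^sub>R x"
    by transfer (auto simp: mult.assoc intro!: L2_scale)
  show "1 *\<^sub>R x = x" by transfer auto
  show "x \<bullet> y = y \<bullet> x"
  proof transfer
    fix x y :: "'a \<Rightarrow> complex"
    show "Re (L2_inner lborel x y) = Re (L2_inner lborel y x)"
      by (subst L2_inner_commute) simp
  qed
  show "(x + y) \<bullet> z = x \<bullet> z + y \<bullet> z"
    by transfer (simp add: L2_inner_def distrib_right L2_mult_integrable)
  show "(a *\<^sub>R x) \<bullet> y = a * (x \<bullet> y)"
    by transfer (simp add: L2_inner_def mult.assoc)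
  show "0 \<le> x \<bullet> x"
    by transfer (simp add: L2_inner_self)
  show "x \<bullet> x = 0 \<longleftrightarrow> x = 0"
    by transfer (simp add: L2_inner_self L2_norm_eq_0[symmetric] L2_norm_def)
qed (simp_all only: norm_lebesgue_L2_def dist_lebesgue_L2_def sgn_lebesgue_L2_def
    uniformity_lebesgue_L2_def open_lebesgue_L2_def)

end

lemma lebesgue_L2_cases:
  obtains f where "f \<in> L2 lborel" "x = abs_lebesgue_L2 f"
  by (rule lebesgue_L2.abs_induct[of "\<lambda>x. (\<forall>f. f \<in> L2 lborel \<longrightarrow> x = abs_lebesgue_L2 f \<longrightarrow> thesis) \<longrightarrow> thesis" x, rule_format])
    (use that in auto)

lemma abs_lebesgue_L2_eq_iff:
  "f \<in> L2 lborel \<Longrightarrow> g \<in> L2 lborel \<Longrightarrow>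
    abs_lebesgue_L2 f = abs_lebesgue_L2 g \<longleftrightarrow> (AE x in lborel. f x = g x)"
  using Quotient3_rel[OF Quotient3_lebesgue_L2, of f g] by auto

lemma norm_abs_lebesgue_L2: "f \<in> L2 lborel \<Longrightarrow> norm (abs_lebesgue_L2 f) = L2_norm lborel f"
  by (simp add: norm_lebesgue_L2_def inner_lebesgue_L2.abs_eq L2_norm_eq_inner)

lemma abs_lebesgue_L2_diff: "f \<in> L2 lborel \<Longrightarrow> g \<in> L2 lborel \<Longrightarrow>
    abs_lebesgue_L2 f - abs_lebesgue_L2 g = abs_lebesgue_L2 (\<lambda>x. f x - g x)"
  by (simp add: minus_lebesgue_L2.abs_eq)

instance lebesgue_L2 :: (euclidean_space) banach
proof
  fix X :: "nat \<Rightarrow> 'a lebesgue_L2"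
  assume X: "Cauchy X"
  have "\<exists>f. f \<in> L2 lborel \<and> X n = abs_lebesgue_L2 f" for n
    by (metis lebesgue_L2_cases)
  then obtain f where f: "\<And>n. f n \<in> L2 lborel" "\<And>n. X n = abs_lebesgue_L2 (f n)"
    by metis
  have norm: "norm (X m - X n) = L2_norm lborel (\<lambda>x. f m x - f n x)" for m n
    by (simp add: f abs_lebesgue_L2_diff norm_abs_lebesgue_L2 L2_diff)
  have "\<exists>N. \<forall>m\<ge>N. \<forall>n\<ge>N. L2_norm lborel (\<lambda>x. f m x - f n x) < e" if "0 < e" for e
    using CauchyD[OF X that] unfolding norm .
  from L2_complete[OF f(1) this] obtain g
    where g: "g \<in> L2 lborel" "(\<lambda>n. L2_norm lborel (\<lambda>x. f n x - g x)) \<longlonglongrightarrow> 0"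
    by blast
  have "(\<lambda>n. norm (X n - abs_lebesgue_L2 g)) \<longlonglongrightarrow> 0"
    using g by (simp add: f abs_lebesgue_L2_diff norm_abs_lebesgue_L2 L2_diff)
  then have "X \<longlonglongrightarrow> abs_lebesgue_L2 g"
    by (rule LIM_zero_cancel[OF tendsto_norm_zero_cancel])
  then show "convergent X" by (rule convergentI)
qed

section \<open>The energy of test functions\<close>

lemma partial_deriv_eqI: "(f has_derivative f') (at x) \<Longrightarrow> partial_deriv b f x = f' b"
  unfolding partial_deriv_def by (simp flip: frechet_derivative_at)

lemma has_derivative_partial_deriv:
  fixes f :: "'a::euclidean_space \<Rightarrow> 'b::real_normed_vector"
  assumes "f differentiable (at x)"
  shows "(f has_derivative (\<lambda>h. \<Sum>b\<in>Basis. (h \<bullet> b) *\<^sub>R partial_deriv b f x)) (at x)"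
proof -
  have D: "(f has_derivative frechet_derivative f (at x)) (at x)"
    using assms by (simp add: frechet_derivative_works)
  have "frechet_derivative f (at x) h = (\<Sum>b\<in>Basis. (h \<bullet> b) *\<^sub>R partial_deriv b f x)" for h
  proof -
    have "frechet_derivative f (at x) h = frechet_derivative f (at x) (\<Sum>b\<in>Basis. (h \<bullet> b) *\<^sub>R b)"
      by (simp add: euclidean_representation)
    also have "\<dots> = (\<Sum>b\<in>Basis. (h \<bullet> b) *\<^sub>R partial_deriv b f x)"
      using has_derivative_linear[OF D] by (simp add: linear_sum linear_scale partial_deriv_def)
    finally show ?thesis .
  qed
  then show ?thesis using D by presburger
qed

lemma C_k_SucD: "C_k (Suc k) f \<Longrightarrow> C_k k f"
proof (induction k arbitrary: f)
  case 0
  then show ?case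
    by (auto intro!: differentiable_imp_continuous_on simp: differentiable_on_def
        intro: differentiable_at_withinI)
next
  case (Suc k)
  have "C_k k (partial_deriv b f)" if "b \<in> Basis" for b
    by (rule Suc.IH) (use Suc.prems that in auto)
  moreover have "\<forall>x. f differentiable (at x)"
    using Suc.prems by simp
  ultimately show ?case by simp
qed

lemma partial_deriv_bounded_linear:
  "bounded_linear L \<Longrightarrow> f differentiable (at x) \<Longrightarrow>
    partial_deriv b (\<lambda>x. L (f x)) x = L (partial_deriv b f x)"
  unfolding partial_deriv_def[of b f]
  by (rule partial_deriv_eqI)
    (simp add: bounded_linear.has_derivative frechet_derivative_works)

lemma C_k_bounded_linear:
  assumes L: "bounded_linear L"
  shows "C_k k f \<Longrightarrow> C_k k (\<lambda>x. L (f x))"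
proof (induction k arbitrary: f)
  case 0
  then show ?case using bounded_linear.continuous_on[OF L] by simp
next
  case (Suc k)
  then have diff: "f differentiable (at x)" for x by simp
  then have "partial_deriv b (\<lambda>x. L (f x)) = (\<lambda>x. L (partial_deriv b f x))" for b
    using partial_deriv_bounded_linear[OF L] by blast
  moreover have "(\<lambda>x. L (f x)) differentiable (at x)" for x
    using bounded_linear.has_derivative[OF L] diff unfolding differentiable_def by blast
  ultimately show ?case using Suc by simp
qed

lemma partial_deriv_add: "f differentiable (at x) \<Longrightarrow> g differentiable (at x) \<Longrightarrow>
    partial_deriv b (\<lambda>x. f x + g x) x = partial_deriv b f x + partial_deriv b g x"
  unfolding partial_deriv_def[of b f] partial_deriv_def[of b g]
  by (rule partial_deriv_eqI) (simp add: has_derivative_add frechet_derivative_works)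

lemma C_k_add: "C_k k f \<Longrightarrow> C_k k g \<Longrightarrow> C_k k (\<lambda>x. f x + g x)"
proof (induction k arbitrary: f g)
  case 0
  then show ?case by (simp add: continuous_on_add)
next
  case (Suc k)
  then have diff: "f differentiable (at x)" "g differentiable (at x)" for x by simp_all
  then have "partial_deriv b (\<lambda>x. f x + g x) = (\<lambda>x. partial_deriv b f x + partial_deriv b g x)" for b
    using partial_deriv_add by blast
  then show ?case using Suc diff by simp
qed

lemma partial_deriv_mult:
  fixes f g :: "'a::euclidean_space \<Rightarrow> real"
  shows "f differentiable (at x) \<Longrightarrow> g differentiable (at x) \<Longrightarrow>
    partial_deriv b (\<lambda>x. f x * g x) x = f x * partial_deriv b g x + partial_deriv b f x * g x"
  unfolding partial_deriv_def[of b f] partial_deriv_def[of b g]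
  by (rule partial_deriv_eqI) (simp add: has_derivative_mult frechet_derivative_works)

lemma C_k_mult:
  fixes f g :: "'a::euclidean_space \<Rightarrow> real"
  shows "C_k k f \<Longrightarrow> C_k k g \<Longrightarrow> C_k k (\<lambda>x. f x * g x)"
proof (induction k arbitrary: f g)
  case 0
  then show ?case by (simp add: continuous_on_mult)
next
  case (Suc k)
  then have diff: "f differentiable (at x)" "g differentiable (at x)" for x by simp_all
  then have "partial_deriv b (\<lambda>x. f x * g x)
      = (\<lambda>x. f x * partial_deriv b g x + partial_deriv b f x * g x)" for b
    using partial_deriv_mult by blast
  \<comment> \<open>In the product rule the undifferentiated factors are needed one order below the
    assumed one, which \<open>C_k_SucD\<close> supplies.\<close>
  moreover have "C_k k (\<lambda>x. f x * partial_deriv b g x + partial_deriv b f x * g x)" if "b \<in> Basis" for b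
    using Suc.prems that by (intro C_k_add Suc.IH C_k_SucD[of k f] C_k_SucD[of k g]) auto
  ultimately show ?case using diff by simp
qed

lemma test_functions_C_k: "\<phi> \<in> test_functions \<Longrightarrow> C_k k \<phi>"
  by (simp add: test_functions_def)

lemma test_functions_continuous: "\<phi> \<in> test_functions \<Longrightarrow> continuous_on UNIV \<phi>"
  using test_functions_C_k[of \<phi> 0] by simp

lemma test_functions_differentiable: "\<phi> \<in> test_functions \<Longrightarrow> \<phi> differentiable (at x)"
  using test_functions_C_k[of \<phi> 1] by simp

lemma test_functions_compact_support:
  assumes "\<phi> \<in> test_functions"
  obtains K where "compact K" "\<And>x. x \<notin> K \<Longrightarrow> \<phi> x = 0"
  using assms closure_subset[of "{x. \<phi> x \<noteq> 0}"] unfolding test_functions_def by blast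

lemma test_functionsI:
  assumes "\<And>k. C_k k \<phi>" "compact K" "\<And>x. x \<notin> K \<Longrightarrow> \<phi> x = 0"
  shows "\<phi> \<in> test_functions"
proof -
  have "closure {x. \<phi> x \<noteq> 0} \<subseteq> K"
    using assms by (intro closure_minimal) (auto simp: compact_imp_closed)
  then have "compact (closure {x. \<phi> x \<noteq> 0})"
    using compact_Int_closed[OF assms(2) closed_closure, of "{x. \<phi> x \<noteq> 0}"] by (simp add: Int_absorb1)
  then show ?thesis using assms(1) by (simp add: test_functions_def)
qed

lemma test_functions_partial_deriv:
  assumes "\<phi> \<in> test_functions" "b \<in> Basis"
  shows "partial_deriv b \<phi> \<in> test_functions"
proof -
  obtain K where K: "compact K" "\<And>x. x \<notin> K \<Longrightarrow> \<phi> x = 0"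
    using test_functions_compact_support[OF assms(1)] by blast
  show ?thesis
  proof (rule test_functionsI[OF _ K(1)])
    show "C_k k (partial_deriv b \<phi>)" for k
      using test_functions_C_k[OF assms(1), of "Suc k"] assms(2) by simp
    show "partial_deriv b \<phi> x = 0" if "x \<notin> K" for x
    proof (rule partial_deriv_eqI)
      have "((\<lambda>x. 0) has_derivative (\<lambda>h. 0)) (at x)" by simp
      then show "(\<phi> has_derivative (\<lambda>h. 0)) (at x)"
        using K that
        by (rule_tac has_derivative_transform_within_open[of _ _ _ _ "- K"])
          (auto simp: compact_imp_closed)
    qed
  qed
qed

lemma test_functions_mult:
  fixes \<phi> \<psi> :: "'a::euclidean_space \<Rightarrow> real"
  assumes "\<phi> \<in> test_functions" "\<psi> \<in> test_functions"
  shows "(\<lambda>x. \<phi> x * \<psi> x) \<in> test_functions"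
proof -
  obtain K where K: "compact K" "\<And>x. x \<notin> K \<Longrightarrow> \<phi> x = 0"
    using test_functions_compact_support[OF assms(1)] by blast
  show ?thesis
    by (rule test_functionsI[OF _ K(1)]) (use K(2) in \<open>simp_all add: C_k_mult test_functions_C_k assms\<close>)
qed

lemma test_functions_bounded_linear:
  assumes "bounded_linear L" "\<phi> \<in> test_functions"
  shows "(\<lambda>x. L (\<phi> x)) \<in> test_functions"
proof -
  obtain K where K: "compact K" "\<And>x. x \<notin> K \<Longrightarrow> \<phi> x = 0"
    using test_functions_compact_support[OF assms(2)] by blast
  have "L 0 = 0"
    using linear_0[OF bounded_linear.linear[OF assms(1)]] .
  then show ?thesis
    by (intro test_functionsI[OF _ K(1)])
      (simp_all add: K(2) C_k_bounded_linear[OF assms(1)] test_functions_C_k assms(2))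
qed

lemma integrable_mult_test_function:
  fixes h \<phi> :: "'a::euclidean_space \<Rightarrow> real"
  assumes h: "h \<in> Lp_loc 1" and \<phi>: "\<phi> \<in> test_functions"
  shows "integrable lborel (\<lambda>x. h x * \<phi> x)"
proof -
  obtain K where K: "compact K" "\<And>x. x \<notin> K \<Longrightarrow> \<phi> x = 0"
    using test_functions_compact_support[OF \<phi>] by blast
  have "compact (\<phi> ` K)"
    using test_functions_continuous[OF \<phi>] continuous_on_subset K(1)
    by (intro compact_continuous_image) blast+
  then obtain C where C: "\<And>x. x \<in> K \<Longrightarrow> norm (\<phi> x) \<le> C"
    using compact_imp_bounded bounded_iff by (metis imageI)
  have [measurable]: "h \<in> borel_measurable borel" "\<phi> \<in> borel_measurable borel"
    using h test_functions_continuous[OF \<phi>] by (auto simp: Lp_loc_def borel_measurable_continuous_onI)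
  have "set_integrable lborel K (\<lambda>x. norm (h x))"
    using h K(1) by (simp add: Lp_loc_def)
  then have "integrable lborel (\<lambda>x. C * (indicator K x *\<^sub>R norm (h x)))"
    unfolding set_integrable_def by (rule integrable_mult_right)
  then show ?thesis
  proof (rule Bochner_Integration.integrable_bound)
    have "norm (h x * \<phi> x) \<le> norm (C * (indicator K x *\<^sub>R norm (h x)))" for x
    proof (cases "x \<in> K")
      case True
      have "\<bar>\<phi> x\<bar> \<le> \<bar>C\<bar>" using C[OF True] by simp
      then show ?thesis
        using True by (simp add: abs_mult mult.commute mult_right_mono)
    qed (simp add: K(2))
    then show "AE x in lborel. norm (h x * \<phi> x) \<le> norm (C * (indicator K x *\<^sub>R norm (h x)))"
      by simp
  qed measurable
qed

section \<open>Cauchy-Schwarz and triangle inequality\<close>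

text \<open>The form with a nonnegative integral serves twice: it bounds the inner product, and with
  the constant function 1 it bounds the L1 norm on a probability space.\<close>

lemma L2_Cauchy_Schwarz:
  assumes "f \<in> L2 M" "g \<in> L2 M"
  shows "(\<integral>\<^sup>+x. ennreal (norm (f x) * norm (g x)) \<partial>M) \<le> ennreal (L2_norm M f * L2_norm M g)"
proof -
  note [measurable] = assms[THEN L2_measurable]
  have eq: "(\<integral>\<^sup>+x. ennreal (norm (h x)) ^ 2 \<partial>M) = ennreal ((L2_norm M h)\<^sup>2)" if "h \<in> L2 M" for h
    using nn_integral_eq_integral[OF L2_integrable_square[OF that]]
    by (simp add: L2_norm_def ennreal_power)
  have "(\<integral>\<^sup>+x. ennreal (norm (f x)) * ennreal (norm (g x)) \<partial>M)\<^sup>2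
      \<le> (\<integral>\<^sup>+x. ennreal (norm (f x)) ^ 2 \<partial>M) * (\<integral>\<^sup>+x. ennreal (norm (g x)) ^ 2 \<partial>M)"
    by (rule Cauchy_Schwarz_nn_integral) measurable
  also have "\<dots> = (ennreal (L2_norm M f * L2_norm M g))\<^sup>2"
    unfolding eq[OF assms(1)] eq[OF assms(2)]
    by (simp add: ennreal_power power_mult_distrib flip: ennreal_mult)
  finally have le: "(\<integral>\<^sup>+x. ennreal (norm (f x)) * ennreal (norm (g x)) \<partial>M)\<^sup>2
      \<le> (ennreal (L2_norm M f * L2_norm M g))\<^sup>2" .
  have "(\<integral>\<^sup>+x. ennreal (norm (f x)) * ennreal (norm (g x)) \<partial>M)
      \<le> ennreal (L2_norm M f * L2_norm M g)"
  proof (cases "\<integral>\<^sup>+x. ennreal (norm (f x)) * ennreal (norm (g x)) \<partial>M")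
    case (real i)
    then show ?thesis
      using le by (auto simp: ennreal_power intro!: ennreal_leI power2_le_imp_le[of i])
  next
    case top
    then show ?thesis using le by (simp add: ennreal_power top_unique)
  qed
  then show ?thesis by (simp add: ennreal_mult)
qed

lemma norm_L2_inner_le:
  assumes "f \<in> L2 M" "g \<in> L2 M"
  shows "norm (L2_inner M f g) \<le> L2_norm M f * L2_norm M g"
proof -
  have "ennreal (norm (L2_inner M f g)) \<le> (\<integral>\<^sup>+x. ennreal (norm (f x * cnj (g x))) \<partial>M)"
    unfolding L2_inner_def by (rule integral_norm_bound_ennreal[OF L2_mult_integrable[OF assms]])
  also have "\<dots> \<le> ennreal (L2_norm M f * L2_norm M g)"
    using L2_Cauchy_Schwarz[OF assms] by (simp add: norm_mult)
  finally show ?thesis by simp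
qed

lemma L2_norm_triangle:
  assumes "f \<in> L2 M" "g \<in> L2 M"
  shows "L2_norm M (\<lambda>x. f x + g x) \<le> L2_norm M f + L2_norm M g"
proof (rule power2_le_imp_le)
  have sq: "(L2_norm M h)\<^sup>2 = Re (L2_inner M h h)" for h
    by (simp add: L2_norm_def L2_inner_self)
  have "L2_inner M (\<lambda>x. f x + g x) (\<lambda>x. f x + g x)
      = L2_inner M f f + L2_inner M f g + (L2_inner M g f + L2_inner M g g)"
    unfolding L2_inner_def complex_cnj_add distrib_left distrib_right
    using assms by (simp add: L2_mult_integrable)
  then have "(L2_norm M (\<lambda>x. f x + g x))\<^sup>2 = (L2_norm M f)\<^sup>2 + (L2_norm M g)\<^sup>2 + 2 * Re (L2_inner M f g)"
    unfolding sq by (simp add: L2_inner_commute[of M g f])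
  also have "Re (L2_inner M f g) \<le> L2_norm M f * L2_norm M g"
    using norm_L2_inner_le[OF assms] complex_Re_le_cmod order_trans by blast
  finally show "(L2_norm M (\<lambda>x. f x + g x))\<^sup>2 \<le> (L2_norm M f + L2_norm M g)\<^sup>2"
    by (simp add: power2_sum)
qed simp

lemma L2_norm_minus_commute: "L2_norm M (\<lambda>x. f x - g x) = L2_norm M (\<lambda>x. g x - f x)"
  by (simp add: L2_norm_def norm_minus_commute)

lemma L2_norm_tendsto:
  assumes f: "\<And>n. f n \<in> L2 M" and h: "h \<in> L2 M"
    and lim: "((\<lambda>n. L2_norm M (\<lambda>x. f n x - h x)) \<longlongrightarrow> 0) F"
  shows "((\<lambda>n. L2_norm M (f n)) \<longlongrightarrow> L2_norm M h) F"
proof (rule LIM_zero_cancel, rule Lim_null_comparison[OF _ lim])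
  have "\<bar>L2_norm M (f n) - L2_norm M h\<bar> \<le> L2_norm M (\<lambda>x. f n x - h x)" for n
    using L2_norm_triangle[OF L2_diff[OF f[of n] h] h] L2_norm_triangle[OF L2_diff[OF h f[of n]] f[of n]]
    by (simp add: L2_norm_minus_commute[of M h])
  then show "\<forall>\<^sub>F n in F. norm (L2_norm M (f n) - L2_norm M h) \<le> L2_norm M (\<lambda>x. f n x - h x)"
    by simp
qed

section \<open>Integration by parts against the weight\<close>

lemma integrable_weighted_measure_iff:
  fixes f :: "'a::euclidean_space \<Rightarrow> 'b::{banach, second_countable_topology}"
  assumes [measurable]: "\<mu> \<in> borel_measurable borel" "f \<in> borel_measurable borel"
    and "\<And>x. 0 \<le> \<mu> x"
  shows "integrable (weighted_measure \<mu>) f \<longleftrightarrow> integrable lborel (\<lambda>x. \<mu> x *\<^sub>R f x)"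
  unfolding weighted_measure_def using assms(3) by (intro integrable_density) auto

lemma integral_weighted_measure:
  fixes f :: "'a::euclidean_space \<Rightarrow> 'b::{banach, second_countable_topology}"
  assumes [measurable]: "\<mu> \<in> borel_measurable borel" "f \<in> borel_measurable borel"
    and "\<And>x. 0 \<le> \<mu> x"
  shows "(\<integral>x. f x \<partial>weighted_measure \<mu>) = (\<integral>x. \<mu> x *\<^sub>R f x \<partial>lborel)"
  unfolding weighted_measure_def using assms(3) by (intro integral_density) auto

lemma sets_weighted_measure [measurable_cong]: "sets (weighted_measure \<mu>) = sets borel"
  by (simp add: weighted_measure_def)

lemma space_weighted_measure [simp]: "space (weighted_measure \<mu>) = UNIV"
  by (simp add: weighted_measure_def)

lemma Lp_loc_inner:
  assumes "g \<in> Lp_loc 1" "b \<in> Basis"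
  shows "(\<lambda>x. g x \<bullet> b) \<in> Lp_loc 1"
proof -
  have [measurable]: "g \<in> borel_measurable borel"
    using assms(1) by (simp add: Lp_loc_def)
  have "set_integrable lborel K (\<lambda>x. norm (g x \<bullet> b))" if K: "compact K" for K
  proof -
    have [measurable]: "K \<in> sets borel"
      using K by (simp add: borel_compact)
    have "set_integrable lborel K (\<lambda>x. norm (g x))"
      using assms(1) K by (simp add: Lp_loc_def)
    then show ?thesis
      unfolding set_integrable_def
    proof (rule Bochner_Integration.integrable_bound)
      have "\<bar>g x \<bullet> b\<bar> \<le> norm (g x)" for x
        by (rule Basis_le_norm[OF assms(2)])
      then show "AE x in lborel. norm (indicator K x *\<^sub>R norm (g x \<bullet> b)) \<le> norm (indicator K x *\<^sub>R norm (g x))"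
        by (auto simp: indicator_def)
    qed measurable
  qed
  then show ?thesis by (simp add: Lp_loc_def)
qed

text \<open>The weak gradient is tested against \<open>p \<partial>\<^sub>b p\<close>.\<close>

lemma weak_gradient_energy:
  fixes p :: "'a::euclidean_space \<Rightarrow> real"
  assumes wg: "weak_gradient \<mu> g" and p: "p \<in> test_functions" and b: "b \<in> Basis"
  defines "F \<equiv> \<lambda>x. (\<mu> x * partial_deriv b (partial_deriv b p) x + (g x \<bullet> b) * partial_deriv b p x) * p x"
  shows "integrable lborel (\<lambda>x. \<mu> x * (partial_deriv b p x)\<^sup>2)" "integrable lborel F"
    "(\<integral>x. \<mu> x * (partial_deriv b p x)\<^sup>2 \<partial>lborel) = - (\<integral>x. F x \<partial>lborel)"
proof -
  have \<mu>: "\<mu> \<in> Lp_loc 1" and gb: "(\<lambda>x. g x \<bullet> b) \<in> Lp_loc 1"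
    using wg b by (auto simp: weak_gradient_def intro: Lp_loc_inner)
  note p1 = test_functions_partial_deriv[OF p b]
  note p2 = test_functions_partial_deriv[OF p1 b]
  have i1: "integrable lborel (\<lambda>x. \<mu> x * (partial_deriv b p x * partial_deriv b p x))"
    and i2: "integrable lborel (\<lambda>x. \<mu> x * (p x * partial_deriv b (partial_deriv b p) x))"
    and i3: "integrable lborel (\<lambda>x. (g x \<bullet> b) * (p x * partial_deriv b p x))"
    by (intro integrable_mult_test_function test_functions_mult \<mu> gb p p1 p2)+
  \<comment> \<open>Where \<mu> does not vanish, \<open>F\<close> is \<open>\<mu> * p\<close> times
    the \<open>b\<close>-th summand of \<open>L p\<close>, with the quotient in the drift cleared.
    Here it is rewritten so that each term is a locally integrable function times a test
    function.\<close>
  have F: "F x = \<mu> x * (p x * partial_deriv b (partial_deriv b p) x) + (g x \<bullet> b) * (p x * partial_deriv b p x)" for x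
    by (simp add: F_def algebra_simps)
  show "integrable lborel F"
    unfolding F[abs_def] by (intro Bochner_Integration.integrable_add i2 i3)
  show "integrable lborel (\<lambda>x. \<mu> x * (partial_deriv b p x)\<^sup>2)"
    using i1 by (simp add: power2_eq_square)
  have "partial_deriv b (\<lambda>x. p x * partial_deriv b p x) x
      = p x * partial_deriv b (partial_deriv b p) x + partial_deriv b p x * partial_deriv b p x" for x
    by (intro partial_deriv_mult test_functions_differentiable p p1)
  moreover have "(\<integral>x. \<mu> x * partial_deriv b (\<lambda>x. p x * partial_deriv b p x) x \<partial>lborel)
      = - (\<integral>x. (g x \<bullet> b) * (p x * partial_deriv b p x) \<partial>lborel)"
    using wg test_functions_mult[OF p p1] b unfolding weak_gradient_def by blast
  ultimately have "(\<integral>x. \<mu> x * (p x * partial_deriv b (partial_deriv b p) x + partial_deriv b p x * partial_deriv b p x) \<partial>lborel)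
      = - (\<integral>x. (g x \<bullet> b) * (p x * partial_deriv b p x) \<partial>lborel)"
    by simp
  then show "(\<integral>x. \<mu> x * (partial_deriv b p x)\<^sup>2 \<partial>lborel) = - (\<integral>x. F x \<partial>lborel)"
    unfolding F power2_eq_square
    by (simp add: distrib_left Bochner_Integration.integral_add[OF i2 i1] Bochner_Integration.integral_add[OF i2 i3])
qed

text \<open>Adding the energy identity over all coordinates and over real and imaginary parts gives
  minus the real part of the product of \<open>L_test \<mu> g \<phi>\<close> with \<phi>, which
  Cauchy-Schwarz bounds. The two membership hypotheses are those that \<open>graph_closure\<close>
  demands of its approximants.\<close>

lemma L2_norm_partial_deriv_le:
  fixes \<phi> :: "'a::euclidean_space \<Rightarrow> complex"
  assumes wg: "weak_gradient \<mu> g" and pos: "\<And>x. 0 < \<mu> x"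
    and \<phi>: "\<phi> \<in> test_functions" "\<phi> \<in> L2 (weighted_measure \<mu>)"
    and L: "L_test \<mu> g \<phi> \<in> L2 (weighted_measure \<mu>)" and b: "b \<in> Basis"
  shows "partial_deriv b \<phi> \<in> L2 (weighted_measure \<mu>)"
    "(L2_norm (weighted_measure \<mu>) (partial_deriv b \<phi>))\<^sup>2
      \<le> L2_norm (weighted_measure \<mu>) (L_test \<mu> g \<phi>) * L2_norm (weighted_measure \<mu>) \<phi>"
proof -
  let ?M = "weighted_measure \<mu>"
  have [measurable]: "\<mu> \<in> borel_measurable borel"
    using wg by (simp add: weak_gradient_def Lp_loc_def)
  \<comment> \<open>The weak gradient is tested against real functions, so the real and imaginary
    parts of \<phi> are treated separately.\<close>
  define p where "p x = Re (\<phi> x)" for x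
  define q where "q x = Im (\<phi> x)" for x
  have p: "p \<in> test_functions" and q: "q \<in> test_functions"
    unfolding p_def[abs_def] q_def[abs_def]
    by (rule test_functions_bounded_linear[OF bounded_linear_Re \<phi>(1)]
        test_functions_bounded_linear[OF bounded_linear_Im \<phi>(1)])+
  have Re: "Re (partial_deriv c \<psi> x) = partial_deriv c (\<lambda>x. Re (\<psi> x)) x"
    and Im: "Im (partial_deriv c \<psi> x) = partial_deriv c (\<lambda>x. Im (\<psi> x)) x"
    if "\<psi> \<in> test_functions" for \<psi> :: "'a \<Rightarrow> complex" and c x
    using partial_deriv_bounded_linear[OF bounded_linear_Re test_functions_differentiable[OF that]]
      partial_deriv_bounded_linear[OF bounded_linear_Im test_functions_differentiable[OF that]]
    by simp_all
  have D1: "Re (partial_deriv c \<phi> x) = partial_deriv c p x" "Im (partial_deriv c \<phi> x) = partial_deriv c q x" for c x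
    by (simp_all add: Re[OF \<phi>(1)] Im[OF \<phi>(1)] p_def[abs_def] q_def[abs_def])
  have D2: "Re (partial_deriv c (partial_deriv c \<phi>) x) = partial_deriv c (partial_deriv c p) x"
      "Im (partial_deriv c (partial_deriv c \<phi>) x) = partial_deriv c (partial_deriv c q) x" if "c \<in> Basis" for c x
    using test_functions_partial_deriv[OF \<phi>(1) that] by (simp_all add: Re Im D1)
  define F where "F c f x = (\<mu> x * partial_deriv c (partial_deriv c f) x + (g x \<bullet> c) * partial_deriv c f x) * f x"
    for c x and f :: "'a \<Rightarrow> real"
  note energy = weak_gradient_energy[OF wg, folded F_def]
  have [measurable]: "partial_deriv c \<phi> \<in> borel_measurable borel" if "c \<in> Basis" for c
    using test_functions_continuous[OF test_functions_partial_deriv[OF \<phi>(1) that]]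
    by (rule borel_measurable_continuous_onI)
  have sq: "(norm (partial_deriv c \<phi> x))\<^sup>2 = (partial_deriv c p x)\<^sup>2 + (partial_deriv c q x)\<^sup>2" for c x
    by (simp add: cmod_power2 D1)
  have int: "integrable lborel (\<lambda>x. \<mu> x * (norm (partial_deriv c \<phi> x))\<^sup>2)" if "c \<in> Basis" for c
    using Bochner_Integration.integrable_add[OF energy(1)[OF p that] energy(1)[OF q that]]
    by (simp add: sq distrib_left)
  have L2: "partial_deriv c \<phi> \<in> L2 ?M" if c: "c \<in> Basis" for c
    using int[OF c] c pos by (simp add: L2_def integrable_weighted_measure_iff less_imp_le)
  then show "partial_deriv b \<phi> \<in> L2 ?M" using b .
  have norm_eq: "(L2_norm ?M (partial_deriv c \<phi>))\<^sup>2
      = - (\<integral>x. F c p x + F c q x \<partial>lborel)" if c: "c \<in> Basis" for c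
  proof -
    have "(L2_norm ?M (partial_deriv c \<phi>))\<^sup>2 = (\<integral>x. \<mu> x * (norm (partial_deriv c \<phi> x))\<^sup>2 \<partial>lborel)"
      using c pos by (simp add: L2_norm_def integral_weighted_measure less_imp_le)
    also have "\<dots> = (\<integral>x. \<mu> x * (partial_deriv c p x)\<^sup>2 \<partial>lborel) + (\<integral>x. \<mu> x * (partial_deriv c q x)\<^sup>2 \<partial>lborel)"
      unfolding sq distrib_left by (intro Bochner_Integration.integral_add energy p q c)
    also have "\<dots> = - ((\<integral>x. F c p x \<partial>lborel) + (\<integral>x. F c q x \<partial>lborel))"
      by (simp add: energy(3)[OF p c] energy(3)[OF q c])
    also have "(\<integral>x. F c p x \<partial>lborel) + (\<integral>x. F c q x \<partial>lborel) = (\<integral>x. F c p x + F c q x \<partial>lborel)"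
      by (intro Bochner_Integration.integral_add[symmetric] energy p q c)
    finally show ?thesis .
  qed
  \<comment> \<open>In the real part of \<open>L_test \<mu> g \<phi> x * cnj (\<phi> x)\<close> the
    products of \<open>p\<close> with \<open>q\<close> cancel, since the coefficients of
    \<open>L\<close> are real. The factor \<open>\<mu> x\<close>, which is positive, clears the
    quotient in the drift.\<close>
  have point: "(\<Sum>c\<in>Basis. F c p x + F c q x) = \<mu> x * Re (L_test \<mu> g \<phi> x * cnj (\<phi> x))" for x
  proof -
    have "L_test \<mu> g \<phi> x * cnj (\<phi> x) = (\<Sum>c\<in>Basis. (partial_deriv c (partial_deriv c \<phi>) x
        + of_real ((g x \<bullet> c) / \<mu> x) * partial_deriv c \<phi> x) * cnj (\<phi> x))"
      unfolding L_test_def sum.distrib[symmetric] sum_distrib_right ..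
    then have "\<mu> x * Re (L_test \<mu> g \<phi> x * cnj (\<phi> x)) = (\<Sum>c\<in>Basis. \<mu> x * Re ((partial_deriv c (partial_deriv c \<phi>) x
        + of_real ((g x \<bullet> c) / \<mu> x) * partial_deriv c \<phi> x) * cnj (\<phi> x)))"
      by (simp only: Re_sum sum_distrib_left)
    also have "\<dots> = (\<Sum>c\<in>Basis. F c p x + F c q x)"
    proof (rule sum.cong[OF refl])
      fix c :: 'a assume c: "c \<in> Basis"
      show "\<mu> x * Re ((partial_deriv c (partial_deriv c \<phi>) x
          + of_real ((g x \<bullet> c) / \<mu> x) * partial_deriv c \<phi> x) * cnj (\<phi> x)) = F c p x + F c q x"
        using pos[of x] by (simp add: F_def D1 D2[OF c] p_def q_def field_simps)
    qed
    finally show ?thesis ..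
  qed
  \<comment> \<open>Only the sum over all directions is expressed by \<open>L\<close>; a single
    direction is bounded by it because the terms are squares.\<close>
  have "(L2_norm ?M (partial_deriv b \<phi>))\<^sup>2 \<le> (\<Sum>c\<in>Basis. (L2_norm ?M (partial_deriv c \<phi>))\<^sup>2)"
    using b by (intro member_le_sum) auto
  also have "\<dots> = - (\<Sum>c\<in>Basis. \<integral>x. F c p x + F c q x \<partial>lborel)"
    by (simp add: norm_eq sum_negf)
  also have "(\<Sum>c\<in>Basis. \<integral>x. F c p x + F c q x \<partial>lborel) = (\<integral>x. (\<Sum>c\<in>Basis. F c p x + F c q x) \<partial>lborel)"
    by (intro Bochner_Integration.integral_sum[symmetric] Bochner_Integration.integrable_add energy p q)
  also have "\<dots> = Re (L2_inner ?M (L_test \<mu> g \<phi>) \<phi>)"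
  proof -
    have int: "integrable ?M (\<lambda>x. L_test \<mu> g \<phi> x * cnj (\<phi> x))"
      by (rule L2_mult_integrable[OF L \<phi>(2)])
    then have "Re (L2_inner ?M (L_test \<mu> g \<phi>) \<phi>) = (\<integral>x. Re (L_test \<mu> g \<phi> x * cnj (\<phi> x)) \<partial>?M)"
      unfolding L2_inner_def by (rule integral_Re[symmetric])
    also have "\<dots> = (\<integral>x. \<mu> x * Re (L_test \<mu> g \<phi> x * cnj (\<phi> x)) \<partial>lborel)"
    proof -
      have "(\<lambda>x. Re (L_test \<mu> g \<phi> x * cnj (\<phi> x))) \<in> borel_measurable borel"
        using measurable_compose[OF borel_measurable_integrable[OF int] borel_measurable_Re]
        by (simp add: measurable_cong_sets[OF sets_weighted_measure refl])
      then show ?thesis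
        using pos by (simp add: integral_weighted_measure less_imp_le)
    qed
    finally show ?thesis by (simp add: point)
  qed
  also have "- Re (L2_inner ?M (L_test \<mu> g \<phi>) \<phi>) \<le> norm (L2_inner ?M (L_test \<mu> g \<phi>) \<phi>)"
    using abs_Re_le_cmod[of "L2_inner ?M (L_test \<mu> g \<phi>) \<phi>"] by linarith
  also have "\<dots> \<le> L2_norm ?M (L_test \<mu> g \<phi>) * L2_norm ?M \<phi>"
    by (rule norm_L2_inner_le[OF L \<phi>(2)])
  finally show "(L2_norm ?M (partial_deriv b \<phi>))\<^sup>2 \<le> L2_norm ?M (L_test \<mu> g \<phi>) * L2_norm ?M \<phi>" .
qed

section \<open>The kernel of \<open>L\<close>\<close>

lemma cball_sets_borel [measurable]: "cball a r \<in> sets (borel :: 'a::metric_space measure)"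
  by (rule borel_closed[OF closed_cball])

lemma nn_integral_lborel_translate:
  fixes c :: "'a::euclidean_space"
  assumes "f \<in> borel_measurable borel"
  shows "(\<integral>\<^sup>+x. f (c + x) \<partial>lborel) = (\<integral>\<^sup>+x. f x \<partial>lborel)"
proof -
  have "(\<integral>\<^sup>+x. f x \<partial>lborel) = (\<integral>\<^sup>+x. f x \<partial>distr lborel borel ((+) c))"
    by (simp add: lborel_distr_plus)
  also have "\<dots> = (\<integral>\<^sup>+x. f (c + x) \<partial>lborel)"
    using assms by (intro nn_integral_distr) auto
  finally show ?thesis ..
qed

lemma AE_lborel_translate:
  fixes c :: "'a::euclidean_space"
  assumes "AE x in lborel. P (c + x)" "{x. P x} \<in> sets borel"
  shows "AE x in lborel. P x"
proof -
  have "AE x in distr lborel borel ((+) c). P x"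
    using assms by (subst AE_distr_iff) auto
  then show ?thesis unfolding lborel_distr_plus .
qed

text \<open>The sum of the moduli, in place of the Euclidean norm, splits into coordinates under the
  integral and still bounds the derivative in direction \<open>h\<close> after multiplication by
  \<open>norm h\<close>.\<close>

definition grad_norm :: "('a::euclidean_space \<Rightarrow> complex) \<Rightarrow> 'a \<Rightarrow> real" where
  "grad_norm \<phi> x = (\<Sum>b\<in>Basis. norm (partial_deriv b \<phi> x))"

text \<open>The fundamental theorem of calculus along the segment from \<open>x\<close> to
  \<open>x + h\<close>. The bound is a nonnegative integral, so that it can be integrated in
  \<open>x\<close> and the order exchanged without integrability conditions.\<close>

lemma norm_diff_le_line_integral:
  fixes \<phi> :: "'a::euclidean_space \<Rightarrow> complex"
  assumes \<phi>: "C_k 1 \<phi>"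
  shows "ennreal (norm (\<phi> (x + h) - \<phi> x))
    \<le> (\<integral>\<^sup>+s. indicator {0..1} s * ennreal (norm h * grad_norm \<phi> (s *\<^sub>R h + x)) \<partial>lborel)"
proof -
  define D where "D s = (\<Sum>b\<in>Basis. (h \<bullet> b) *\<^sub>R partial_deriv b \<phi> (s *\<^sub>R h + x))" for s :: real
  have cont: "continuous_on UNIV (partial_deriv b \<phi>)" if "b \<in> Basis" for b
    using \<phi> that by simp
  have D_cont: "continuous_on A D" for A
    unfolding D_def
    by (intro continuous_on_sum continuous_on_scaleR continuous_on_const
        continuous_on_compose2[OF cont] continuous_intros) auto
  have deriv: "((\<lambda>s. \<phi> (s *\<^sub>R h + x)) has_vector_derivative D s) (at s within {0..1})" for s
  proof -
    have "((\<lambda>s. s *\<^sub>R h + x) has_derivative (\<lambda>t. t *\<^sub>R h)) (at s within {0..1})"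
      by (auto intro!: derivative_eq_intros)
    moreover have "\<phi> differentiable (at (s *\<^sub>R h + x))"
      using \<phi> by simp
    ultimately have "((\<lambda>s. \<phi> (s *\<^sub>R h + x)) has_derivative
        (\<lambda>t. \<Sum>b\<in>Basis. (t *\<^sub>R h \<bullet> b) *\<^sub>R partial_deriv b \<phi> (s *\<^sub>R h + x))) (at s within {0..1})"
      by (intro has_derivative_compose[OF _ has_derivative_partial_deriv])
    then show ?thesis
      by (simp add: has_vector_derivative_def D_def scaleR_sum_right)
  qed
  have "(\<integral>s. indicator {0..1} s *\<^sub>R D s \<partial>lborel) = \<phi> (1 *\<^sub>R h + x) - \<phi> (0 *\<^sub>R h + x)"
    using deriv D_cont by (intro integral_FTC_atLeastAtMost) auto
  then have "ennreal (norm (\<phi> (x + h) - \<phi> x)) = ennreal (norm (\<integral>s. indicator {0..1} s *\<^sub>R D s \<partial>lborel))"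
    by (simp add: add.commute)
  also have "\<dots> \<le> (\<integral>\<^sup>+s. ennreal (norm (indicator {0..1} s *\<^sub>R D s)) \<partial>lborel)"
  proof (rule integral_norm_bound_ennreal)
    show "integrable lborel (\<lambda>s. indicator {0..1} s *\<^sub>R D s)"
      using borel_integrable_compact[OF compact_Icc D_cont, of 0 1]
      by (simp add: indicator_scaleR_eq_if)
  qed
  also have "\<dots> \<le> (\<integral>\<^sup>+s. indicator {0..1} s * ennreal (norm h * grad_norm \<phi> (s *\<^sub>R h + x)) \<partial>lborel)"
  proof (rule nn_integral_mono)
    fix s :: real
    have "norm (D s) \<le> (\<Sum>b\<in>Basis. norm ((h \<bullet> b) *\<^sub>R partial_deriv b \<phi> (s *\<^sub>R h + x)))"
      unfolding D_def by (rule norm_sum)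
    also have "\<dots> \<le> (\<Sum>b\<in>Basis. norm h * norm (partial_deriv b \<phi> (s *\<^sub>R h + x)))"
      by (intro sum_mono) (simp add: Basis_le_norm mult_right_mono)
    also have "\<dots> = norm h * grad_norm \<phi> (s *\<^sub>R h + x)"
      by (simp add: grad_norm_def sum_distrib_left)
    finally show "ennreal (norm (indicator {0..1} s *\<^sub>R D s))
        \<le> indicator {0..1} s * ennreal (norm h * grad_norm \<phi> (s *\<^sub>R h + x))"
      by (auto simp: indicator_def intro: ennreal_leI)
  qed
  finally show ?thesis .
qed

text \<open>After the order of integration is exchanged, the inner integral runs over a translate by
  \<open>s *\<^sub>R h\<close>. The enlarged ball contains every such translate with
  \<open>s\<close> between 0 and 1, and once its indicator is part of the integrand, translation
  invariance makes the inner integral independent of \<open>s\<close>.\<close>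

lemma nn_integral_translation_diff_le:
  fixes \<phi> :: "'a::euclidean_space \<Rightarrow> complex"
  assumes \<phi>: "C_k 1 \<phi>"
  shows "(\<integral>\<^sup>+x. indicator (cball 0 R) x * ennreal (norm (\<phi> (x + h) - \<phi> x)) \<partial>lborel)
    \<le> (\<integral>\<^sup>+x. indicator (cball 0 (R + norm h)) x * ennreal (norm h * grad_norm \<phi> x) \<partial>lborel)"
proof -
  have "continuous_on UNIV (grad_norm \<phi>)"
    unfolding grad_norm_def[abs_def] using \<phi> by (intro continuous_intros) auto
  then have [measurable]: "grad_norm \<phi> \<in> borel_measurable borel"
    by (rule borel_measurable_continuous_onI)
  define F where "F x = indicator (cball 0 (R + norm h)) x * ennreal (norm h * grad_norm \<phi> x)" for x
  have [measurable]: "F \<in> borel_measurable borel"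
    unfolding F_def by measurable
  have "(\<integral>\<^sup>+x. indicator (cball 0 R) x * ennreal (norm (\<phi> (x + h) - \<phi> x)) \<partial>lborel)
      \<le> (\<integral>\<^sup>+x. (\<integral>\<^sup>+s. indicator {0..1} s * F (s *\<^sub>R h + x) \<partial>lborel) \<partial>lborel)"
  proof (rule nn_integral_mono)
    fix x :: 'a
    show "indicator (cball 0 R) x * ennreal (norm (\<phi> (x + h) - \<phi> x))
        \<le> (\<integral>\<^sup>+s. indicator {0..1} s * F (s *\<^sub>R h + x) \<partial>lborel)"
    proof (cases "x \<in> cball 0 R")
      case True
      have "indicator {0..1} s * ennreal (norm h * grad_norm \<phi> (s *\<^sub>R h + x)) \<le> indicator {0..1} s * F (s *\<^sub>R h + x)"
        for s :: real
      proof (cases "s \<in> {0..1}")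
        case s: True
        then have "\<bar>s\<bar> * norm h \<le> norm h"
          using mult_right_mono[of "\<bar>s\<bar>" 1 "norm h"] by simp
        then have "norm (s *\<^sub>R h + x) \<le> R + norm h"
          using norm_triangle_ineq[of "s *\<^sub>R h" x] True by simp
        then show ?thesis by (simp add: F_def)
      qed simp
      then have "(\<integral>\<^sup>+s. indicator {0..1} s * ennreal (norm h * grad_norm \<phi> (s *\<^sub>R h + x)) \<partial>lborel)
          \<le> (\<integral>\<^sup>+s. indicator {0..1} s * F (s *\<^sub>R h + x) \<partial>lborel)"
        by (intro nn_integral_mono)
      from order_trans[OF norm_diff_le_line_integral[OF \<phi>] this] True show ?thesis
        by simp
    qed simp
  qed
  also have "\<dots> = (\<integral>\<^sup>+s. (\<integral>\<^sup>+x. indicator {0..1} s * F (s *\<^sub>R h + x) \<partial>lborel) \<partial>lborel)"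
    by (rule lborel_pair.Fubini') measurable
  also have "\<dots> = (\<integral>\<^sup>+s. indicator {0..1} s * (\<integral>\<^sup>+x. F x \<partial>lborel) \<partial>(lborel :: real measure))"
    by (simp add: nn_integral_cmult nn_integral_lborel_translate)
  also have "\<dots> = (\<integral>\<^sup>+x. F x \<partial>lborel)"
    by (simp add: nn_integral_multc)
  finally show ?thesis by (simp add: F_def)
qed

text \<open>The exceptional null set depends on \<open>h\<close>, so no point can be fixed at once.
  Fubini exchanges the quantifiers: for almost every \<open>x\<close> the equation holds for almost
  all \<open>h\<close>, and a single such \<open>x\<close> provides the constant.\<close>

lemma translation_invariant_imp_constant:
  fixes u :: "'a::euclidean_space \<Rightarrow> complex"
  assumes [measurable]: "u \<in> borel_measurable borel"
    and inv: "\<And>h. AE x in lborel. u (x + h) = u x"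
  obtains c where "AE x in lborel. u x = c"
proof -
  have "AE h in lborel. AE x in lborel. u (x + h) = u x"
    using inv by simp
  moreover have "{z \<in> space (lborel \<Otimes>\<^sub>M lborel). u (fst z + snd z) = u (fst z)} \<in> sets (lborel \<Otimes>\<^sub>M lborel)"
    by measurable
  ultimately have "AE x in lborel. AE h in lborel. u (x + h) = u x"
    by (subst lborel_pair.AE_commute)
  moreover have "ae_filter (lborel :: 'a measure) \<noteq> bot"
    by (simp add: trivial_limit_def[symmetric] ae_filter_eq_bot_iff)
  ultimately obtain x where "AE h in lborel. u (x + h) = u x"
    using eventually_happens by blast
  then have "AE y in lborel. u y = u x"
    by (rule AE_lborel_translate[where P = "\<lambda>y. u y = u x"]) measurable
  then show ?thesis by (rule that)
qed

section \<open>From weighted norms to Lebesgue integrals on balls\<close>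

lemma nn_integral_norm_le_L2_norm:
  assumes "prob_space M" "f \<in> L2 M"
  shows "(\<integral>\<^sup>+x. ennreal (norm (f x)) \<partial>M) \<le> ennreal (L2_norm M f)"
proof -
  interpret prob_space M by fact
  have "(\<lambda>x. 1) \<in> L2 M" by (simp add: L2_def)
  from L2_Cauchy_Schwarz[OF assms(2) this] show ?thesis
    by (simp add: L2_norm_def prob_space)
qed

text \<open>The lower bound \<open>m\<close> of the density replaces Lebesgue measure on the ball by
  the weighted measure at the cost \<open>1 / m\<close>, and on a probability space the L1 norm is
  at most the L2 norm.\<close>

lemma nn_integral_ball_le:
  fixes f :: "'a::euclidean_space \<Rightarrow> complex"
  assumes prob: "prob_space (weighted_measure \<mu>)" and [measurable]: "\<mu> \<in> borel_measurable borel"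
    and m: "0 < m" "\<And>x. x \<in> cball 0 R \<Longrightarrow> m \<le> \<mu> x"
    and f: "f \<in> L2 (weighted_measure \<mu>)"
  shows "(\<integral>\<^sup>+x. indicator (cball 0 R) x * ennreal (norm (f x)) \<partial>lborel)
    \<le> ennreal (L2_norm (weighted_measure \<mu>) f / m)"
proof -
  have [measurable]: "f \<in> borel_measurable borel"
    using L2_measurable[OF f] by simp
  have "(\<integral>\<^sup>+x. indicator (cball 0 R) x * ennreal (norm (f x)) \<partial>lborel)
      \<le> (\<integral>\<^sup>+x. ennreal (1 / m) * (ennreal (\<mu> x) * ennreal (norm (f x))) \<partial>lborel)"
  proof (rule nn_integral_mono)
    fix x
    have "ennreal (norm (f x)) \<le> ennreal (1 / m) * (ennreal (\<mu> x) * ennreal (norm (f x)))"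
      if x: "x \<in> cball 0 R"
    proof -
      have "norm (f x) \<le> 1 / m * (\<mu> x * norm (f x))"
        using m(1) m(2)[OF x] mult_right_mono[of m "\<mu> x" "norm (f x)"] by (simp add: field_simps)
      then have "ennreal (norm (f x)) \<le> ennreal (1 / m * (\<mu> x * norm (f x)))"
        by (rule ennreal_leI)
      also have "\<dots> = ennreal (1 / m) * (ennreal (\<mu> x) * ennreal (norm (f x)))"
        using m(1) m(2)[OF x] by (subst ennreal_mult, simp, simp, subst ennreal_mult) auto
      finally show ?thesis .
    qed
    then show "indicator (cball 0 R) x * ennreal (norm (f x)) \<le> ennreal (1 / m) * (ennreal (\<mu> x) * ennreal (norm (f x)))"
      by (simp add: indicator_def)
  qed
  also have "\<dots> = ennreal (1 / m) * (\<integral>\<^sup>+x. ennreal (norm (f x)) \<partial>weighted_measure \<mu>)"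
    by (simp add: nn_integral_cmult weighted_measure_def nn_integral_density)
  also have "\<dots> \<le> ennreal (1 / m) * ennreal (L2_norm (weighted_measure \<mu>) f)"
    by (intro mult_left_mono nn_integral_norm_le_L2_norm prob f) simp
  also have "\<dots> = ennreal (L2_norm (weighted_measure \<mu>) f / m)"
    using m(1) by (simp add: mult.commute flip: ennreal_mult)
  finally show ?thesis .
qed

text \<open>The limit \<open>u\<close> has no derivative to work with, so its increments are
  compared with those of \<phi>, whose size is governed by the gradients. All estimates are local,
  which is why lower bounds of the density on balls are enough.\<close>

lemma L2_limit_constant:
  fixes u :: "'a::euclidean_space \<Rightarrow> complex"
  assumes prob: "prob_space (weighted_measure \<mu>)" and \<mu>: "\<mu> \<in> borel_measurable borel"
    and lower: "\<And>R. \<exists>m>0. \<forall>x\<in>cball 0 R. m \<le> \<mu> x"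
    and u: "u \<in> L2 (weighted_measure \<mu>)"
    and \<phi>: "\<And>n::nat. C_k 1 (\<phi> n)" "\<And>n. \<phi> n \<in> L2 (weighted_measure \<mu>)"
    and lim: "(\<lambda>n. L2_norm (weighted_measure \<mu>) (\<lambda>x. \<phi> n x - u x)) \<longlonglongrightarrow> 0"
    and D: "\<And>n b. b \<in> Basis \<Longrightarrow> partial_deriv b (\<phi> n) \<in> L2 (weighted_measure \<mu>)"
    and Dlim: "\<And>b. b \<in> Basis \<Longrightarrow> (\<lambda>n. L2_norm (weighted_measure \<mu>) (partial_deriv b (\<phi> n))) \<longlonglongrightarrow> 0"
  obtains c where "AE x in lborel. u x = c"
proof -
  let ?M = "weighted_measure \<mu>"
  note [measurable] = \<mu>
  have [measurable]: "u \<in> borel_measurable borel" "\<phi> n \<in> borel_measurable borel" for n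
    using L2_measurable[OF u] L2_measurable[OF \<phi>(2)] by auto
  have Dm: "partial_deriv b (\<phi> n) \<in> borel_measurable borel" if "b \<in> Basis" for b n
    using L2_measurable[OF D[OF that]] by auto
  have "AE x in lborel. u (x + h) = u x" for h
  proof -
    have "AE x in lborel. x \<in> cball 0 (real R) \<longrightarrow> u (x + h) = u x" for R :: nat
    proof -
      obtain m where m: "0 < m" "\<And>x. x \<in> cball 0 (real R + norm h) \<Longrightarrow> m \<le> \<mu> x"
        using lower[of "real R + norm h"] by blast
      \<comment> \<open>The three summands bound the error of \<open>\<phi> n\<close> at the shifted
        point, the increment of \<open>\<phi> n\<close>, and the error at \<open>x\<close>. The
        radius \<open>real R + norm h\<close> accommodates the shifted point as well.\<close>
      define B where "B n = L2_norm ?M (\<lambda>x. \<phi> n x - u x) / m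
          + norm h * (\<Sum>b\<in>Basis. L2_norm ?M (partial_deriv b (\<phi> n)) / m)
          + L2_norm ?M (\<lambda>x. \<phi> n x - u x) / m" for n
      let ?i = "\<lambda>x. indicator (cball 0 (real R + norm h)) x :: ennreal"
      let ?j = "\<lambda>x. indicator (cball 0 (real R)) x :: ennreal"
      have ball: "(\<integral>\<^sup>+x. ?i x * ennreal (norm (f x)) \<partial>lborel) \<le> ennreal (L2_norm ?M f / m)"
        if "f \<in> L2 ?M" for f
        by (rule nn_integral_ball_le[OF prob \<mu> m that])
      have le: "(\<integral>\<^sup>+x. ?j x * ennreal (norm (u (x + h) - u x)) \<partial>lborel) \<le> ennreal (B n)" for n
      proof -
        have d: "(\<lambda>x. \<phi> n x - u x) \<in> L2 ?M" by (intro L2_diff \<phi> u)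
        have "(\<integral>\<^sup>+x. ?j x * ennreal (norm (u (x + h) - u x)) \<partial>lborel)
            \<le> (\<integral>\<^sup>+x. ?i (h + x) * ennreal (norm (\<phi> n (h + x) - u (h + x)))
              + ?j x * ennreal (norm (\<phi> n (x + h) - \<phi> n x))
              + ?i x * ennreal (norm (\<phi> n x - u x)) \<partial>lborel)"
        proof (rule nn_integral_mono)
          fix x :: 'a
          show "?j x * ennreal (norm (u (x + h) - u x)) \<le> ?i (h + x) * ennreal (norm (\<phi> n (h + x) - u (h + x)))
              + ?j x * ennreal (norm (\<phi> n (x + h) - \<phi> n x))
              + ?i x * ennreal (norm (\<phi> n x - u x))"
          proof (cases "x \<in> cball 0 (real R)")
            case True
            then have "norm x \<le> real R" by simp
            then have "norm x \<le> real R + norm h" "norm (h + x) \<le> real R + norm h"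
              using norm_triangle_ineq[of h x] norm_ge_zero[of h] by linarith+
            then have i: "?i x = 1" "?i (h + x) = 1" "?j x = 1"
              using True by auto
            have "u (x + h) - u x = (\<phi> n (x + h) - \<phi> n x) - (\<phi> n (h + x) - u (h + x)) + (\<phi> n x - u x)"
              by (simp add: add.commute)
            also have "norm \<dots> \<le> norm (\<phi> n (x + h) - \<phi> n x) + norm (\<phi> n (h + x) - u (h + x)) + norm (\<phi> n x - u x)"
              by (intro norm_triangle_le add_right_mono norm_triangle_ineq4)
            finally show ?thesis
              unfolding i by (simp add: add_ac flip: ennreal_plus)
          qed simp
        qed
        also have "\<dots> = (\<integral>\<^sup>+x. ?i (h + x) * ennreal (norm (\<phi> n (h + x) - u (h + x))) \<partial>lborel)
            + (\<integral>\<^sup>+x. ?j x * ennreal (norm (\<phi> n (x + h) - \<phi> n x)) \<partial>lborel)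
            + (\<integral>\<^sup>+x. ?i x * ennreal (norm (\<phi> n x - u x)) \<partial>lborel)"
          by (subst nn_integral_add, measurable, subst nn_integral_add, measurable)
        also have "(\<integral>\<^sup>+x. ?i (h + x) * ennreal (norm (\<phi> n (h + x) - u (h + x))) \<partial>lborel)
            = (\<integral>\<^sup>+x. ?i x * ennreal (norm (\<phi> n x - u x)) \<partial>lborel)"
          by (rule nn_integral_lborel_translate[where f = "\<lambda>x. ?i x * ennreal (norm (\<phi> n x - u x))"]) measurable
        also have "(\<integral>\<^sup>+x. ?i x * ennreal (norm (\<phi> n x - u x)) \<partial>lborel)
            + (\<integral>\<^sup>+x. ?j x * ennreal (norm (\<phi> n (x + h) - \<phi> n x)) \<partial>lborel)
            + (\<integral>\<^sup>+x. ?i x * ennreal (norm (\<phi> n x - u x)) \<partial>lborel)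
          \<le> ennreal (L2_norm ?M (\<lambda>x. \<phi> n x - u x) / m)
            + ennreal (norm h * (\<Sum>b\<in>Basis. L2_norm ?M (partial_deriv b (\<phi> n)) / m))
            + ennreal (L2_norm ?M (\<lambda>x. \<phi> n x - u x) / m)"
        proof (intro add_mono ball d)
          have "(\<integral>\<^sup>+x. ?j x * ennreal (norm (\<phi> n (x + h) - \<phi> n x)) \<partial>lborel)
              \<le> (\<integral>\<^sup>+x. ?i x * ennreal (norm h * grad_norm (\<phi> n) x) \<partial>lborel)"
            by (rule nn_integral_translation_diff_le[OF \<phi>(1)])
          also have "\<dots> = (\<integral>\<^sup>+x. ennreal (norm h) * (\<Sum>b\<in>Basis. ?i x * ennreal (norm (partial_deriv b (\<phi> n) x))) \<partial>lborel)"
          proof (rule nn_integral_cong)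
            fix x :: 'a
            have "ennreal (norm h * grad_norm (\<phi> n) x) = ennreal (norm h) * (\<Sum>b\<in>Basis. ennreal (norm (partial_deriv b (\<phi> n) x)))"
              by (simp add: grad_norm_def ennreal_mult sum_nonneg sum_ennreal)
            then show "?i x * ennreal (norm h * grad_norm (\<phi> n) x)
                = ennreal (norm h) * (\<Sum>b\<in>Basis. ?i x * ennreal (norm (partial_deriv b (\<phi> n) x)))"
              by (simp only: sum_distrib_left[symmetric] mult.left_commute)
          qed
          also have "\<dots> = ennreal (norm h) * (\<Sum>b\<in>Basis. \<integral>\<^sup>+x. ?i x * ennreal (norm (partial_deriv b (\<phi> n) x)) \<partial>lborel)"
          proof -
            have [measurable]: "(\<lambda>x. ?i x * ennreal (norm (partial_deriv b (\<phi> n) x))) \<in> borel_measurable lborel"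
              if "b \<in> Basis" for b
              using Dm[OF that] by measurable
            have "(\<lambda>x. \<Sum>b\<in>Basis. ?i x * ennreal (norm (partial_deriv b (\<phi> n) x))) \<in> borel_measurable lborel"
              by (rule borel_measurable_sum) measurable
            then show ?thesis
              by (subst nn_integral_cmult, assumption, subst nn_integral_sum, measurable)
          qed
          also have "\<dots> \<le> ennreal (norm h) * (\<Sum>b\<in>Basis. ennreal (L2_norm ?M (partial_deriv b (\<phi> n)) / m))"
            by (intro mult_left_mono sum_mono ball D) auto
          also have "\<dots> = ennreal (norm h * (\<Sum>b\<in>Basis. L2_norm ?M (partial_deriv b (\<phi> n)) / m))"
            using m(1) by (simp add: ennreal_mult sum_nonneg sum_ennreal)
          finally show "(\<integral>\<^sup>+x. ?j x * ennreal (norm (\<phi> n (x + h) - \<phi> n x)) \<partial>lborel)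
              \<le> ennreal (norm h * (\<Sum>b\<in>Basis. L2_norm ?M (partial_deriv b (\<phi> n)) / m))" .
        qed
        also have "\<dots> = ennreal (B n)"
          using m(1) by (simp add: B_def sum_nonneg flip: ennreal_plus)
        finally show ?thesis .
      qed
      have "B \<longlonglongrightarrow> 0 / m + norm h * (\<Sum>b\<in>(Basis :: 'a set). 0 / m) + 0 / m"
        unfolding B_def[abs_def] using m(1) by (intro tendsto_intros lim Dlim) auto
      then have "(\<lambda>n. ennreal (B n)) \<longlonglongrightarrow> 0"
        using tendsto_ennrealI[of B 0] by simp
      then have "(\<integral>\<^sup>+x. ?j x * ennreal (norm (u (x + h) - u x)) \<partial>lborel) \<le> 0"
        by (rule LIMSEQ_le_const) (use le in auto)
      then have "AE x in lborel. ?j x * ennreal (norm (u (x + h) - u x)) = 0"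
        by (subst nn_integral_0_iff_AE[symmetric]) simp_all
      then show ?thesis
        by eventually_elim (auto simp: indicator_def split: if_splits)
    qed
    then have "AE x in lborel. \<forall>R::nat. x \<in> cball 0 (real R) \<longrightarrow> u (x + h) = u x"
      unfolding AE_all_countable by blast
    then show ?thesis
    proof eventually_elim
      case (elim x)
      then show ?case using real_arch_simple[of "norm x"] by auto
    qed
  qed
  from translation_invariant_imp_constant[OF _ this] show ?thesis
    using that by auto
qed

lemma L_op_kernel_constant:
  fixes u :: "'a::euclidean_space \<Rightarrow> complex"
  assumes prob: "prob_space (weighted_measure \<mu>)"
    and wg: "weak_gradient \<mu> g" and pos: "\<And>x. 0 < \<mu> x"
    and lower: "\<And>R. \<exists>m>0. \<forall>x\<in>cball 0 R. m \<le> \<mu> x"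
    and ker: "(u, w) \<in> L_op \<mu> g" "L2_norm (weighted_measure \<mu>) w = 0"
  obtains c where "AE x in lborel. u x = c"
proof -
  let ?M = "weighted_measure \<mu>"
  have u: "u \<in> L2 ?M" and w: "w \<in> L2 ?M"
    using ker(1) by (auto simp: L_op_def graph_closure_def)
  obtain \<phi> \<psi> where seq: "\<And>n::nat. (\<phi> n, \<psi> n) \<in> {(\<phi>, L_test \<mu> g \<phi>) | \<phi>. \<phi> \<in> test_functions}"
      "\<And>n. \<phi> n \<in> L2 ?M" "\<And>n. \<psi> n \<in> L2 ?M"
    and lim: "(\<lambda>n. L2_norm ?M (\<lambda>x. \<phi> n x - u x)) \<longlonglongrightarrow> 0" "(\<lambda>n. L2_norm ?M (\<lambda>x. \<psi> n x - w x)) \<longlonglongrightarrow> 0"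
    using ker(1) unfolding L_op_def graph_closure_def by blast
  have test: "\<phi> n \<in> test_functions" and \<psi>: "\<psi> n = L_test \<mu> g (\<phi> n)" for n
    using seq(1)[of n] by auto
  have L: "L_test \<mu> g (\<phi> n) \<in> L2 ?M" for n
    using seq(3) by (simp add: \<psi>)
  note grad = L2_norm_partial_deriv_le[OF wg pos test seq(2) L]
  have Dlim: "(\<lambda>n. L2_norm ?M (partial_deriv b (\<phi> n))) \<longlonglongrightarrow> 0" if b: "b \<in> Basis" for b
  proof -
    \<comment> \<open>The norms of \<open>\<phi> n\<close> converge and hence stay bounded, so the
      energy bound vanishes in the limit together with the norms of \<open>\<psi> n\<close>.\<close>
    have "(\<lambda>n. L2_norm ?M (\<psi> n) * L2_norm ?M (\<phi> n)) \<longlonglongrightarrow> L2_norm ?M w * L2_norm ?M u"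
      by (intro tendsto_mult L2_norm_tendsto seq u w lim)
    then have "(\<lambda>n. L2_norm ?M (\<psi> n) * L2_norm ?M (\<phi> n)) \<longlonglongrightarrow> 0"
      by (simp add: ker(2))
    then have "(\<lambda>n. (L2_norm ?M (partial_deriv b (\<phi> n)))\<^sup>2) \<longlonglongrightarrow> 0"
      by (rule tendsto_sandwich[OF _ _ tendsto_const, rotated 2])
        (use grad(2)[OF b] in \<open>simp_all add: \<psi>\<close>)
    then show ?thesis by simp
  qed
  have "\<mu> \<in> borel_measurable borel"
    using wg by (simp add: weak_gradient_def Lp_loc_def)
  then show ?thesis
    using L2_limit_constant[OF prob _ lower u test_functions_C_k[OF test] seq(2) lim(1) grad(1) Dlim] that
    by blast
qed

section \<open>Convergence of the semigroup\<close>

lemma eventually_at_right_0I: "(\<And>t. 0 < t \<Longrightarrow> P t) \<Longrightarrow> \<forall>\<^sub>F t in at_right (0::real). P t"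
  by (auto simp: eventually_at_filter)

section \<open>The unitary map from the weighted space to the quotient space\<close>

locale positive_density =
  fixes \<mu> :: "'a::euclidean_space \<Rightarrow> real"
  assumes measurable_density [measurable]: "\<mu> \<in> borel_measurable borel"
    and density_pos: "0 < \<mu> x"
begin

abbreviation M :: "'a measure" where "M \<equiv> weighted_measure \<mu>"

text \<open>An isometry because the squared modulus of the product is the density times the squared
  modulus of \<open>f\<close>, and surjective because the density vanishes nowhere. For the same
  reason both measures have the same null sets.\<close>

definition embed :: "('a \<Rightarrow> complex) \<Rightarrow> 'a lebesgue_L2" where
  "embed f = abs_lebesgue_L2 (\<lambda>x. of_real (sqrt (\<mu> x)) * f x)"

lemma AE_M_iff: "(AE x in M. P x) \<longleftrightarrow> (AE x in lborel. P x)"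
  unfolding weighted_measure_def by (subst AE_density) (simp_all add: density_pos)

lemma L2_M_iff: "f \<in> L2 M \<longleftrightarrow> (\<lambda>x. of_real (sqrt (\<mu> x)) * f x) \<in> L2 lborel"
proof -
  have "f \<in> borel_measurable borel \<longleftrightarrow> (\<lambda>x. of_real (sqrt (\<mu> x)) * f x) \<in> borel_measurable borel"
  proof
    have m: "(\<lambda>x. complex_of_real (sqrt (\<mu> x))) \<in> borel_measurable borel"
      by measurable
    assume "(\<lambda>x. of_real (sqrt (\<mu> x)) * f x) \<in> borel_measurable borel"
    then have "(\<lambda>x. of_real (sqrt (\<mu> x)) * f x / of_real (sqrt (\<mu> x))) \<in> borel_measurable borel"
      by (rule borel_measurable_divide[OF _ m])
    moreover have "of_real (sqrt (\<mu> x)) * f x / of_real (sqrt (\<mu> x)) = f x" for x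
      using density_pos[of x] by simp
    ultimately show "f \<in> borel_measurable borel" by simp
  next
    assume [measurable]: "f \<in> borel_measurable borel"
    show "(\<lambda>x. of_real (sqrt (\<mu> x)) * f x) \<in> borel_measurable borel"
      by measurable
  qed
  moreover have "(norm (of_real (sqrt (\<mu> x)) * f x))\<^sup>2 = \<mu> x * (norm (f x))\<^sup>2" for x
    using density_pos[of x] by (simp add: norm_mult power_mult_distrib)
  ultimately show ?thesis
    using density_pos by (auto simp: L2_def integrable_weighted_measure_iff less_imp_le
        measurable_cong_sets[OF sets_weighted_measure refl])
qed

lemma inner_embed:
  assumes "f \<in> L2 M" "g \<in> L2 M"
  shows "embed f \<bullet> embed g = Re (L2_inner M f g)"
proof -
  have [measurable]: "(\<lambda>x. f x * cnj (g x)) \<in> borel_measurable borel"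
    using borel_measurable_integrable[OF L2_mult_integrable[OF assms]] by simp
  have "complex_of_real (sqrt (\<mu> x)) * f x * cnj (of_real (sqrt (\<mu> x)) * g x) = \<mu> x *\<^sub>R (f x * cnj (g x))" for x
  proof -
    have "complex_of_real (sqrt (\<mu> x)) * complex_of_real (sqrt (\<mu> x)) = of_real (\<mu> x)"
      using density_pos[of x] by (simp flip: of_real_mult)
    then show ?thesis
      by (simp add: scaleR_conv_of_real mult_ac)
  qed
  then have "L2_inner lborel (\<lambda>x. of_real (sqrt (\<mu> x)) * f x) (\<lambda>x. of_real (sqrt (\<mu> x)) * g x) = L2_inner M f g"
    unfolding L2_inner_def using density_pos
    by (subst integral_weighted_measure) (simp_all add: less_imp_le)
  then show ?thesis
    using assms unfolding embed_def by (simp add: inner_lebesgue_L2.abs_eq L2_M_iff)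
qed

lemma norm_embed: "f \<in> L2 M \<Longrightarrow> norm (embed f) = L2_norm M f"
  by (simp add: norm_eq_sqrt_inner inner_embed L2_norm_eq_inner)

lemma embed_eq_iff:
  assumes "f \<in> L2 M" "g \<in> L2 M"
  shows "embed f = embed g \<longleftrightarrow> (AE x in M. f x = g x)"
  using assms density_pos unfolding embed_def
  by (subst abs_lebesgue_L2_eq_iff) (simp_all add: L2_M_iff AE_M_iff less_imp_neq[symmetric])

lemma embed_add: "f \<in> L2 M \<Longrightarrow> g \<in> L2 M \<Longrightarrow> embed (\<lambda>x. f x + g x) = embed f + embed g"
  unfolding embed_def by (simp add: plus_lebesgue_L2.abs_eq L2_M_iff distrib_left)

lemma embed_diff: "f \<in> L2 M \<Longrightarrow> g \<in> L2 M \<Longrightarrow> embed (\<lambda>x. f x - g x) = embed f - embed g"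
  unfolding embed_def by (simp add: minus_lebesgue_L2.abs_eq L2_M_iff right_diff_distrib)

lemma embed_scaleR: "f \<in> L2 M \<Longrightarrow> embed (\<lambda>x. of_real c * f x) = c *\<^sub>R embed f"
  unfolding embed_def by (simp add: scaleR_lebesgue_L2.abs_eq L2_M_iff mult.left_commute)

lemma embed_surj:
  obtains f where "f \<in> L2 M" "x = embed f"
proof -
  obtain f where f: "f \<in> L2 lborel" "x = abs_lebesgue_L2 f"
    by (rule lebesgue_L2_cases)
  have eq: "(\<lambda>x. of_real (sqrt (\<mu> x)) * (f x / of_real (sqrt (\<mu> x)))) = f"
    using density_pos by (simp add: less_imp_neq[symmetric])
  show ?thesis
    by (rule that[of "\<lambda>x. f x / of_real (sqrt (\<mu> x))"]) (simp_all only: L2_M_iff embed_def eq f)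
qed

text \<open>The choice of a representative makes this meaningful only for operators \<open>F\<close> that respect equality
  almost everywhere.\<close>

definition transport :: "(('a \<Rightarrow> complex) \<Rightarrow> ('a \<Rightarrow> complex)) \<Rightarrow> 'a lebesgue_L2 \<Rightarrow> 'a lebesgue_L2" where
  "transport F x = embed (F (SOME f. f \<in> L2 M \<and> x = embed f))"

text \<open>Additivity and the norm bound already force \<open>F\<close> to respect equality almost
  everywhere: the difference of two representatives has norm 0, so its image has norm 0. Hence the
  chosen representative does not matter.\<close>

lemma transport_embed:
  assumes F: "\<And>f. f \<in> L2 M \<Longrightarrow> F f \<in> L2 M"
    and add: "\<And>f g. f \<in> L2 M \<Longrightarrow> g \<in> L2 M \<Longrightarrow> AE x in M. F (\<lambda>y. f y + g y) x = F f x + F g x"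
    and bound: "\<And>f. f \<in> L2 M \<Longrightarrow> L2_norm M (F f) \<le> C * L2_norm M f"
    and f: "f \<in> L2 M"
  shows "transport F (embed f) = embed (F f)"
proof -
  define g where "g = (SOME g. g \<in> L2 M \<and> embed f = embed g)"
  have g: "g \<in> L2 M" "embed f = embed g"
    using someI[of "\<lambda>g. g \<in> L2 M \<and> embed f = embed g" f] f by (auto simp: g_def)
  have d: "(\<lambda>x. g x - f x) \<in> L2 M" by (rule L2_diff[OF g(1) f])
  have "L2_norm M (\<lambda>x. g x - f x) = 0"
    using norm_embed[OF d] by (simp add: embed_diff g f flip: g(2))
  then have "L2_norm M (F (\<lambda>x. g x - f x)) = 0"
    using bound[OF d] by (simp add: order_antisym)
  then have "embed (F (\<lambda>x. g x - f x)) = 0"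
    using norm_embed[OF F[OF d]] by simp
  moreover have "embed (F g) = embed (\<lambda>x. F f x + F (\<lambda>y. g y - f y) x)"
    using add[OF f d] by (subst embed_eq_iff) (auto intro!: F L2_add f d g)
  ultimately have "embed (F g) = embed (F f)"
    by (simp add: embed_add F f d)
  then show ?thesis by (simp add: transport_def g_def)
qed

end

section \<open>The semigroup of the theorem on the quotient space\<close>

locale positive_density_semigroup = positive_density \<mu> for \<mu> :: "'a::euclidean_space \<Rightarrow> real" +
  fixes T :: "real \<Rightarrow> ('a \<Rightarrow> complex) \<Rightarrow> ('a \<Rightarrow> complex)" and g :: "'a \<Rightarrow> 'a"
  assumes T: "C0_semigroup M T"
    and gen_T: "generator M T = {(u, \<lambda>x. - f x) | u f. (u, f) \<in> A_op \<mu> g}"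
begin

lemmas T_axioms = T[unfolded C0_semigroup_def]
lemmas T_L2 = T_axioms[THEN conjunct1, rule_format]
  and T_add = T_axioms[THEN conjunct2, THEN conjunct1, rule_format]
  and T_scale = T_axioms[THEN conjunct2, THEN conjunct2, THEN conjunct1, rule_format]
  and T_bound = T_axioms[THEN conjunct2, THEN conjunct2, THEN conjunct2, THEN conjunct1, rule_format]
  and T_0 = T_axioms[THEN conjunct2, THEN conjunct2, THEN conjunct2, THEN conjunct2, THEN conjunct1, rule_format]
  and T_plus = T_axioms[THEN conjunct2, THEN conjunct2, THEN conjunct2, THEN conjunct2, THEN conjunct2,
      THEN conjunct1, rule_format]
  and T_tendsto = T_axioms[THEN conjunct2, THEN conjunct2, THEN conjunct2, THEN conjunct2, THEN conjunct2,
      THEN conjunct2, rule_format]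

abbreviation S :: "real \<Rightarrow> 'a lebesgue_L2 \<Rightarrow> 'a lebesgue_L2" where
  "S t \<equiv> transport (T t)"

lemma S_embed: "0 \<le> t \<Longrightarrow> f \<in> L2 M \<Longrightarrow> S t (embed f) = embed (T t f)"
proof -
  assume t: "0 \<le> t" and f: "f \<in> L2 M"
  obtain C where C: "\<forall>f\<in>L2 M. L2_norm M (T t f) \<le> C * L2_norm M f"
    using T_bound[OF t] by blast
  show ?thesis
    by (rule transport_embed[of "T t" C, OF T_L2[OF t] T_add[OF t] C[rule_format] f])
qed

sublocale linear_C0_semigroup S
proof (rule linear_C0_semigroup.intro)
  fix t :: real assume t: "0 \<le> t"
  obtain C where C: "\<forall>f\<in>L2 M. L2_norm M (T t f) \<le> C * L2_norm M f"
    using T_bound[OF t] by blast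
  show "bounded_linear (S t)"
  proof (rule bounded_linear_intro[where K = C])
    fix x y :: "'a lebesgue_L2" and c :: real
    obtain f where f: "f \<in> L2 M" "x = embed f" by (rule embed_surj)
    obtain h where h: "h \<in> L2 M" "y = embed h" by (rule embed_surj)
    have "S t (x + y) = embed (T t (\<lambda>z. f z + h z))"
      by (simp add: f h S_embed t L2_add flip: embed_add)
    also have "\<dots> = embed (\<lambda>z. T t f z + T t h z)"
      using T_add[OF t f(1) h(1)] by (subst embed_eq_iff) (auto intro!: T_L2 L2_add t f h)
    finally show "S t (x + y) = S t x + S t y"
      by (simp add: f h S_embed t embed_add T_L2)
    have "S t (c *\<^sub>R x) = embed (T t (\<lambda>z. of_real c * f z))"
      by (simp add: f S_embed t L2_scale flip: embed_scaleR)
    also have "\<dots> = embed (\<lambda>z. of_real c * T t f z)"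
      using T_scale[OF t f(1)] by (subst embed_eq_iff) (auto intro!: T_L2 L2_scale t f)
    finally show "S t (c *\<^sub>R x) = c *\<^sub>R S t x"
      by (simp add: f S_embed t embed_scaleR T_L2)
    show "norm (S t x) \<le> norm x * C"
      using C f by (simp add: S_embed t norm_embed T_L2 mult.commute)
  qed
next
  fix x :: "'a lebesgue_L2"
  obtain f where f: "f \<in> L2 M" "x = embed f" by (rule embed_surj)
  show "S 0 x = x"
    using T_0[OF f(1)] f by (simp add: S_embed embed_eq_iff T_L2)
  show "S (s + t) x = S s (S t x)" if "0 \<le> s" "0 \<le> t" for s t
    using T_plus[OF that f(1)] that f by (simp add: S_embed embed_eq_iff T_L2)
  have "((\<lambda>t. norm (S t x - x)) \<longlongrightarrow> 0) (at_right 0)"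
    using T_tendsto[OF f(1)]
  proof (rule Lim_transform_eventually)
    show "\<forall>\<^sub>F t in at_right 0. L2_norm M (\<lambda>x. T t f x - f x) = norm (S t x - x)"
      by (rule eventually_at_right_0I)
        (simp add: f S_embed T_L2 L2_diff flip: norm_embed embed_diff)
  qed
  then show "((\<lambda>t. S t x) \<longlongrightarrow> x) (at_right 0)"
    by (rule LIM_zero_cancel[OF tendsto_norm_zero_cancel])
qed

lemma gen_embed_iff:
  assumes u: "u \<in> L2 M" and v: "v \<in> L2 M"
  shows "gen (embed u) (embed v) \<longleftrightarrow> (u, v) \<in> generator M T"
proof -
  have eq: "norm ((S t (embed u) - embed u) /\<^sub>R t - embed v)
      = L2_norm M (\<lambda>x. (T t u x - u x) / of_real t - v x)" if "0 < t" for t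
  proof -
    have d: "(\<lambda>x. T t u x - u x) \<in> L2 M"
      using that by (intro L2_diff T_L2 u) auto
    have e: "(\<lambda>x. (T t u x - u x) / of_real t) = (\<lambda>x. of_real (inverse t) * (T t u x - u x))"
      by (simp add: divide_inverse mult.commute)
    have "(S t (embed u) - embed u) /\<^sub>R t = embed (\<lambda>x. (T t u x - u x) / of_real t)"
      using that unfolding e
      by (simp only: embed_scaleR[OF d] embed_diff[OF T_L2[OF less_imp_le u] u] S_embed[OF less_imp_le u])
    moreover have "(\<lambda>x. (T t u x - u x) / of_real t) \<in> L2 M"
      unfolding e by (rule L2_scale[OF d])
    ultimately show ?thesis
      by (simp add: v L2_diff flip: embed_diff norm_embed)
  qed
  have "gen (embed u) (embed v) \<longleftrightarrow>
      ((\<lambda>t. norm ((S t (embed u) - embed u) /\<^sub>R t - embed v)) \<longlongrightarrow> 0) (at_right 0)"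
    unfolding gen_def by (simp only: tendsto_norm_zero_iff LIM_zero_iff)
  also have "\<dots> \<longleftrightarrow> ((\<lambda>t. L2_norm M (\<lambda>x. (T t u x - u x) / of_real t - v x)) \<longlongrightarrow> 0) (at_right 0)"
    by (intro tendsto_cong eventually_at_right_0I eq)
  finally show ?thesis using u v by (simp add: generator_def)
qed

text \<open>Here \<open>w\<close> plays the role of \<open>L u\<close> and \<open>v\<close> that of
  \<open>- A u\<close>: the weak definition of \<open>A\<close> is brought into a form that can be
  tested with any element of the graph of \<open>L\<close>.\<close>

lemma gen_embedD:
  assumes "gen (embed u) (embed v)" "u \<in> L2 M" "v \<in> L2 M"
  obtains w where "(u, w) \<in> L_op \<mu> g" "w \<in> L2 M"
    "\<And>u' w'. (u', w') \<in> L_op \<mu> g \<Longrightarrow> L2_inner M w w' = - L2_inner M v u'"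
proof -
  obtain f where f: "v = (\<lambda>x. - f x)" "(u, f) \<in> A_op \<mu> g"
    using assms gen_embed_iff[OF assms(2,3)] gen_T by auto
  obtain w where w: "(u, w) \<in> L_op \<mu> g" "\<forall>(v, z)\<in>L_op \<mu> g. L2_inner M w z = L2_inner M f v"
    using f(2) by (auto simp: A_op_def)
  have "L2_inner M w w' = - L2_inner M v u'" if "(u', w') \<in> L_op \<mu> g" for u' w'
    using w(2) that by (auto simp: f(1) L2_inner_def)
  moreover have "w \<in> L2 M"
    using w(1) by (auto simp: L_op_def graph_closure_def)
  ultimately show ?thesis using that w(1) by blast
qed

text \<open>The product of \<open>- A u\<close> with \<open>u'\<close> is minus the product of
  \<open>L u\<close> with \<open>L u'\<close>. This expression is symmetric after taking real parts,
  and for \<open>u' = u\<close> it is minus a squared norm.\<close>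

sublocale symmetric_C0_semigroup S
proof (rule symmetric_C0_semigroup.intro[OF linear_C0_semigroup_axioms symmetric_C0_semigroup_axioms.intro])
  fix x y x' y' :: "'a lebesgue_L2"
  assume g1: "gen x y"
  obtain u where u: "u \<in> L2 M" "x = embed u" by (rule embed_surj)
  obtain v where v: "v \<in> L2 M" "y = embed v" by (rule embed_surj)
  obtain w where w: "(u, w) \<in> L_op \<mu> g" "w \<in> L2 M"
    "\<And>u' w'. (u', w') \<in> L_op \<mu> g \<Longrightarrow> L2_inner M w w' = - L2_inner M v u'"
    using gen_embedD[of u v] g1 u v by metis
  have "y \<bullet> x = - Re (L2_inner M w w)"
    using w(3)[OF w(1)] u v by (simp add: inner_embed)
  then show "y \<bullet> x \<le> 0" by (simp add: L2_inner_self)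
  assume g2: "gen x' y'"
  obtain u' where u': "u' \<in> L2 M" "x' = embed u'" by (rule embed_surj)
  obtain v' where v': "v' \<in> L2 M" "y' = embed v'" by (rule embed_surj)
  obtain w' where w': "(u', w') \<in> L_op \<mu> g" "w' \<in> L2 M"
    "\<And>u w. (u, w) \<in> L_op \<mu> g \<Longrightarrow> L2_inner M w' w = - L2_inner M v' u"
    using gen_embedD[of u' v'] g2 u' v' by metis
  have "y \<bullet> x' = - Re (L2_inner M w w')" "y' \<bullet> x = - Re (L2_inner M w' w)"
    using w(3)[OF w'(1)] w'(3)[OF w(1)] u v u' v' by (simp_all add: inner_embed)
  moreover have "Re (L2_inner M w' w) = Re (L2_inner M w w')"
    by (subst L2_inner_commute) simp
  ultimately show "y \<bullet> x' = x \<bullet> y'" by (simp add: inner_commute)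
qed

text \<open>\<open>A u = 0\<close> gives \<open>\<integral> |L u|\<^sup>2 d\<mu> = 0\<close>.\<close>

lemma fixed_point_in_kernel:
  assumes "\<And>t. 0 \<le> t \<Longrightarrow> S t (embed k) = embed k" "k \<in> L2 M"
  obtains w where "(k, w) \<in> L_op \<mu> g" "L2_norm M w = 0"
proof -
  have "gen (embed k) (embed (\<lambda>x. 0))"
  proof -
    have "embed (\<lambda>x. 0) = 0"
      using embed_scaleR[OF L2_zero, of 0] by simp
    moreover have "((\<lambda>t. (S t (embed k) - embed k) /\<^sub>R t) \<longlongrightarrow> 0) (at_right 0)"
      by (rule Lim_transform_eventually[OF tendsto_const[of 0]])
        (rule eventually_at_right_0I, simp add: assms(1))
    ultimately show ?thesis by (simp add: gen_def)
  qed
  then obtain w where "(k, w) \<in> L_op \<mu> g" "w \<in> L2 M" "L2_inner M w w = - L2_inner M (\<lambda>x. 0) k"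
    using gen_embedD[OF _ assms(2) L2_zero] by metis
  then show ?thesis using that by (simp add: L2_norm_eq_inner L2_inner_def)
qed

text \<open>The constant is the mean of \<open>f\<close> if the constants belong to the domain of \<open>L\<close>, and \<open>0\<close>
  otherwise.\<close>

lemma tendsto_nonneg_constant:
  assumes prob: "prob_space M" and wg: "weak_gradient \<mu> g"
    and lower: "\<And>R. \<exists>m>0. \<forall>x\<in>cball 0 R. m \<le> \<mu> x"
    and f: "f \<in> L2 M" "AE x in M. f x \<in> \<real> \<and> 0 \<le> Re (f x)"
  obtains a :: real where "0 \<le> a" "((\<lambda>t. L2_norm M (\<lambda>x. T t f x - of_real a)) \<longlongrightarrow> 0) at_top"
proof -
  interpret prob_space M by fact
  have prob_UNIV: "prob UNIV = 1" using prob_space by simp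
  obtain h where h: "((\<lambda>t. S t (embed f)) \<longlongrightarrow> h) at_top" "\<And>s. 0 \<le> s \<Longrightarrow> S s h = h"
    "\<And>k. (\<And>s. 0 \<le> s \<Longrightarrow> S s k = k) \<Longrightarrow> h \<bullet> k = embed f \<bullet> k"
    using orbit_converges[of "embed f"] by blast
  obtain k where k: "k \<in> L2 M" "h = embed k" by (rule embed_surj)
  obtain w where w: "(k, w) \<in> L_op \<mu> g" "L2_norm M w = 0"
    using fixed_point_in_kernel[of k] h(2) k by blast
  obtain c where "AE x in lborel. k x = c"
    by (rule L_op_kernel_constant[OF prob wg density_pos lower w])
  then have c: "AE x in M. k x = c"
    by (simp add: AE_M_iff)
  have const: "(\<lambda>x. z) \<in> L2 M" for z :: complex
    by (simp add: L2_def)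
  have h_eq: "h = embed (\<lambda>x. c)"
    using c k const by (simp add: embed_eq_iff)
  \<comment> \<open>The abstract theory knows only real multiples. Complex linearity of
    \<open>T s\<close> keeps complex multiples of \<open>c\<close> fixed as well, which restores the
    complex orthogonality relation.\<close>
  have fixed: "S s (embed (\<lambda>x. z * c)) = embed (\<lambda>x. z * c)" if s: "0 \<le> s" for s z
  proof -
    have "AE x in M. T s (\<lambda>x. c) x = c"
      using h(2)[OF s] by (simp add: h_eq S_embed s embed_eq_iff T_L2 const)
    moreover have "AE x in M. T s (\<lambda>x. z * c) x = z * T s (\<lambda>x. c) x"
      by (rule T_scale[OF s const])
    ultimately have "AE x in M. T s (\<lambda>x. z * c) x = z * c"
      by eventually_elim simp
    then show ?thesis
      by (simp add: S_embed s embed_eq_iff T_L2 const)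
  qed
  define m where "m = (\<integral>x. Re (f x) \<partial>M)"
  have "0 \<le> m"
    unfolding m_def by (rule integral_nonneg_AE) (use f(2) in auto)
  have f_int: "integrable M f"
    using L2_mult_integrable[OF f(1) const[of 1]] by simp
  have "(\<integral>x. f x \<partial>M) = (\<integral>x. complex_of_real (Re (f x)) \<partial>M)"
  proof (rule integral_cong_AE)
    show "AE x in M. f x = complex_of_real (Re (f x))"
      using f(2) by eventually_elim (simp add: of_real_Re)
  qed (use L2_measurable[OF f(1)] in measurable)
  then have int_f: "(\<integral>x. f x \<partial>M) = of_real m"
    by (simp add: m_def)
  \<comment> \<open>The projection property of the limit, tested with the fixed vector
    \<open>z * c\<close>. The value \<open>z = 1\<close> determines the squared modulus of
    \<open>c\<close>, and \<open>z = \<i>\<close> controls its imaginary part.\<close>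
  have eq: "Re (c * cnj (z * c)) = m * Re (z * c)" for z
  proof -
    have "embed (\<lambda>x. c) \<bullet> embed (\<lambda>x. z * c) = embed f \<bullet> embed (\<lambda>x. z * c)"
      using h(3)[OF fixed] by (simp add: h_eq)
    moreover have "L2_inner M (\<lambda>x. c) (\<lambda>x. z * c) = c * cnj (z * c)"
      by (simp add: L2_inner_def prob_UNIV)
    moreover have "L2_inner M f (\<lambda>x. z * c) = of_real m * cnj (z * c)"
      using f_int by (simp add: L2_inner_def int_f)
    ultimately show ?thesis
      by (simp add: inner_embed const f(1))
  qed
  have eq1: "(Re c)\<^sup>2 + (Im c)\<^sup>2 = m * Re c"
    using eq[of 1] by (simp add: power2_eq_square)
  have eq2: "m * Im c = 0"
    using eq[of \<i>] by (simp add: algebra_simps)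
  \<comment> \<open>A nonzero imaginary part would force \<open>m = 0\<close>, and then the squared
    modulus of \<open>c\<close> would be 0.\<close>
  have "Im c = 0"
  proof (rule ccontr)
    assume "Im c \<noteq> 0"
    then have "(Re c)\<^sup>2 + (Im c)\<^sup>2 = 0" using eq1 eq2 by simp
    then show False using \<open>Im c \<noteq> 0\<close> by simp
  qed
  then have c_real: "c = of_real (Re c)"
    by (simp add: complex_eq_iff)
  \<comment> \<open>Now \<open>(Re c)\<^sup>2 = m * Re c\<close>, so a negative real part would make
    a positive square nonpositive. The equation leaves exactly the two values \<open>0\<close> and
    \<open>m\<close>.\<close>
  have "0 \<le> Re c"
  proof (rule ccontr)
    assume neg: "\<not> 0 \<le> Re c"
    then have "m * Re c \<le> 0" using \<open>0 \<le> m\<close> by (simp add: mult_nonneg_nonpos)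
    moreover have "0 < (Re c)\<^sup>2" using neg by simp
    moreover have "(Re c)\<^sup>2 = m * Re c" using eq1 \<open>Im c = 0\<close> by simp
    ultimately show False by linarith
  qed
  moreover have "((\<lambda>t. L2_norm M (\<lambda>x. T t f x - of_real (Re c))) \<longlongrightarrow> 0) at_top"
  proof (rule Lim_transform_eventually)
    show "((\<lambda>t. norm (S t (embed f) - embed (\<lambda>x. c))) \<longlongrightarrow> 0) at_top"
      using tendsto_norm_zero[OF LIM_zero[OF h(1)]] by (simp add: h_eq)
    show "\<forall>\<^sub>F t in at_top. norm (S t (embed f) - embed (\<lambda>x. c)) = L2_norm M (\<lambda>x. T t f x - of_real (Re c))"
      using eventually_ge_at_top[of 0] unfolding c_real[symmetric]
      by eventually_elim (simp add: S_embed f(1) T_L2 const L2_diff flip: norm_embed embed_diff)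
  qed
  ultimately show ?thesis by (rule that)
qed

end

section \<open>The distance to the positive functions\<close>

lemma L2_infdist_L2_pos_tendsto:
  assumes prob: "prob_space (weighted_measure \<mu>)" and a: "0 \<le> a"
    and F: "\<forall>\<^sub>F t in F. h t \<in> L2 (weighted_measure \<mu>)"
    and lim: "((\<lambda>t. L2_norm (weighted_measure \<mu>) (\<lambda>x. h t x - of_real a)) \<longlongrightarrow> 0) F"
  shows "((\<lambda>t. L2_infdist (weighted_measure \<mu>) (h t) (L2_pos (weighted_measure \<mu>))) \<longlongrightarrow> 0) F"
proof (rule tendstoI)
  let ?M = "weighted_measure \<mu>"
  interpret prob_space ?M by fact
  have prob_UNIV: "prob UNIV = 1" using prob_space by simp
  fix e :: real assume e: "0 < e"
  \<comment> \<open>For \<open>a = 0\<close> the limit itself is not in \<open>L2_pos\<close>, which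
    asks for strict positivity on a set of positive measure. Adding \<open>e / 2\<close> repairs
    this for every \<open>a\<close> and costs exactly \<open>e / 2\<close> in norm, the total mass
    being 1.\<close>
  define q :: "'a \<Rightarrow> complex" where "q x = of_real (a + e / 2)" for x
  have const: "(\<lambda>x. z) \<in> L2 ?M" for z :: complex
    by (simp add: L2_def)
  have q: "q \<in> L2_pos ?M"
    using a e const[of "of_real (a + e / 2)"] unfolding L2_pos_def q_def[abs_def]
    by (auto intro!: bexI[of _ UNIV])
  have bdd: "bdd_below ((\<lambda>g. L2_norm ?M (\<lambda>x. h t x - g x)) ` L2_pos ?M)" for t
    by (rule bdd_belowI2[of _ 0]) simp
  have "\<forall>\<^sub>F t in F. L2_norm ?M (\<lambda>x. h t x - of_real a) < e / 2"
    using order_tendstoD(2)[OF lim, of "e / 2"] e by simp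
  then show "\<forall>\<^sub>F t in F. dist (L2_infdist ?M (h t) (L2_pos ?M)) 0 < e"
    using F
  proof eventually_elim
    case (elim t)
    have "0 \<le> L2_infdist ?M (h t) (L2_pos ?M)"
      unfolding L2_infdist_def using q by (intro cINF_greatest) auto
    moreover have "L2_infdist ?M (h t) (L2_pos ?M) \<le> L2_norm ?M (\<lambda>x. h t x - q x)"
      unfolding L2_infdist_def by (rule cINF_lower[OF bdd q])
    moreover have "L2_norm ?M (\<lambda>x. h t x - q x) \<le> L2_norm ?M (\<lambda>x. h t x - of_real a) + L2_norm ?M (\<lambda>x. - of_real (e / 2))"
      using L2_norm_triangle[OF L2_diff[OF elim(2) const[of "of_real a"]] const[of "- of_real (e / 2)"]]
      by (simp add: q_def algebra_simps)
    moreover have "L2_norm ?M (\<lambda>x. - of_real (e / 2)) = e / 2"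
      using e by (simp add: L2_norm_def prob_UNIV)
    ultimately show ?case using elim(1) by simp
  qed
qed

theorem proposition3p6:
  fixes \<mu> :: "'a::euclidean_space \<Rightarrow> real"
    and g :: "'a \<Rightarrow> 'a"
    and r :: real
    and T :: "real \<Rightarrow> ('a \<Rightarrow> complex) \<Rightarrow> ('a \<Rightarrow> complex)"
  assumes nonneg: "\<And>x. 0 \<le> \<mu> x"
    and integrable: "integrable lborel \<mu>"
    and prob: "prob_space (weighted_measure \<mu>)"
    and H1: "\<mu> \<in> H1_loc"
    and grad: "weak_gradient \<mu> g"
    and r: "r > real DIM('a)"
    and drift: "(\<lambda>x. g x /\<^sub>R \<mu> x) \<in> Lp_loc r"
    and lower: "\<And>K. compact K \<Longrightarrow> K \<noteq> {} \<Longrightarrow> (INF x\<in>K. \<mu> x) > 0"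
    and semigroup: "C0_semigroup (weighted_measure \<mu>) T"
    and gen: "generator (weighted_measure \<mu>) T = {(u, \<lambda>x. - f x) | u f. (u, f) \<in> A_op \<mu> g}"
  shows "asymptotically_irreducible (weighted_measure \<mu>) T"
  unfolding asymptotically_irreducible_def
proof
  have pos: "0 < \<mu> x" for x
    using lower[of "{x}"] by simp
  \<comment> \<open>For negative \<open>R\<close> the ball is empty and its infimum has no meaning,
    so any positive \<open>m\<close> is taken. Otherwise the infimum over the compact ball is the
    bound.\<close>
  have ball: "\<exists>m>0. \<forall>x\<in>cball 0 R. m \<le> \<mu> x" for R
  proof (cases "R < 0")
    case False
    then have "0 < (INF x\<in>cball 0 R. \<mu> x)"
      by (intro lower) auto
    moreover have "(INF x\<in>cball 0 R. \<mu> x) \<le> \<mu> x" if "x \<in> cball 0 R" for x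
      using that by (intro cINF_lower bdd_belowI2[of _ 0] nonneg)
    ultimately show ?thesis by blast
  qed (auto intro: exI[of _ 1])
  interpret positive_density_semigroup \<mu> T g
    using integrable pos semigroup gen by unfold_locales (auto dest: borel_measurable_integrable)
  fix f assume "f \<in> L2_pos (weighted_measure \<mu>)"
  then have f: "f \<in> L2 M" "AE x in M. f x \<in> \<real> \<and> 0 \<le> Re (f x)"
    by (auto simp: L2_pos_def)
  obtain a :: real where a: "0 \<le> a" "((\<lambda>t. L2_norm M (\<lambda>x. T t f x - of_real a)) \<longlongrightarrow> 0) at_top"
    by (rule tendsto_nonneg_constant[OF prob grad ball f])
  \<comment> \<open>For negative times nothing is known about \<open>T t\<close>; the limit at
    infinity sees only times from 0 on.\<close>
  have "\<forall>\<^sub>F t in at_top. T t f \<in> L2 M"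
    using eventually_ge_at_top[of 0] by eventually_elim (rule T_L2[OF _ f(1)])
  then show "((\<lambda>t. L2_infdist (weighted_measure \<mu>) (T t f) (L2_pos (weighted_measure \<mu>))) \<longlongrightarrow> 0) at_top"
    by (rule L2_infdist_L2_pos_tendsto[OF prob a(1) _ a(2)])
qed

end
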